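(* Let $q$ be a prime power with $q\equiv 3\pmod 4$, and suppose there are infinitely many primes $p$ with $p\equiv 3\pmod 4$, $\gcd(p,q)=1$, $\mathrm{ord}_{4p}(q)=p-1$ and $\mathrm{ord}_p(q)\equiv 2\pmod 4$ (this holds, e.g., if infinitely many primes $p\equiv 3 \pmod 4$ have $q$ as a primitive root). For such $p$ put $n=2p$. Then: (1) there is an infinite family of self-dual double-negacirculant codes $C_h$ over $\mathbb{F}_q$, of lengths $2n$ (with $n=2p$, $p$ ranging over such primes), whose relative distance $\delta$ satisfies $H_q(\delta)\ge \frac18$; (2) there is an infinite family of self-dual four-negacirculant codes $C_{a,b}$ over $\mathbb{F}_q$, of lengths $4n$, whose relative distance $\delta$ satisfies $H_q(\delta)\ge\frac1{16}$.
   Context: $R=\mathbb{F}_q[x]/\langle x^n+1\rangle$. For $a=\sum a_ix^i\in R$, its negacirculant matrix is the $n\times n$ matrix with first row $(a_0,\dots,a_{n-1})$, each subsequent row being the negashift $(x_0,\dots,x_{n-1})\mapsto(-x_{n-1},x_0,\dots,x_{n-2})$ of the previous one. A double-negacirculant code $C_h$ ($h\in R$, matrix $H$) is the code of length $2n$ generated by $(I_n\ H)$; a four-negacirculant code $C_{a,b}$ ($a,b\in R$, matrices $A,B$) is the code of length $4n$ generated by $\begin{pmatrix} I_n & 0 & A & B\\ 0 & I_n & -B^t & A^t\end{pmatrix}$. Self-duality is with respect to the Euclidean inner product. For a family of codes of lengths $N\to\infty$ and minimum distances $d_N$, the relative distance is $\delta=\liminf d_N/N$. The $q$-ary entropy function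 is $H_q(t)=t\log_q(q-1)-t\log_q t-(1-t)\log_q(1-t)$ for $0<t<\frac{q-1}{q}$ and $H_q(0)=0$. $\mathrm{ord}_m(q)$ is the multiplicative order of $q$ modulo $m$. *)

theory Defs
  imports "HOL-Analysis.Analysis" "HOL-Number_Theory.Number_Theory" "HOL-Library.Infinite_Set"
begin

(* Vectors of length N over a field are functions nat => 'a vanishing outside {0..<N}.
   Matrices are functions nat => nat => 'a (row index, column index). *)

(* negacirculant n x n matrix of a = sum a_i x^i in F[x]/(x^n+1):
   first row (a_0,...,a_{n-1}), each row the negashift of the previous one *)
definition negacirc :: "nat \<Rightarrow> (nat \<Rightarrow> 'a::ring_1) \<Rightarrow> nat \<Rightarrow> nat \<Rightarrow> 'a" where
  "negacirc n a i j = (if i \<le> j then a (j - i) else - a (n + j - i))"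

definition transp_mat :: "(nat \<Rightarrow> nat \<Rightarrow> 'a) \<Rightarrow> nat \<Rightarrow> nat \<Rightarrow> 'a" where
  "transp_mat M i j = M j i"

definition id_mat :: "nat \<Rightarrow> nat \<Rightarrow> 'a::ring_1" where
  "id_mat i j = (if i = j then 1 else 0)"

definition gen_code :: "nat \<Rightarrow> nat \<Rightarrow> (nat \<Rightarrow> nat \<Rightarrow> 'a::field) \<Rightarrow> (nat \<Rightarrow> 'a) set" where
  "gen_code k N G = {c. \<exists>u. c = (\<lambda>j. if j < N then (\<Sum>i<k. u i * G i j) else 0)}"

definition dual_code :: "nat \<Rightarrow> (nat \<Rightarrow> 'a::field) set \<Rightarrow> (nat \<Rightarrow> 'a) set" where
  "dual_code N C = {y. (\<forall>j\<ge>N. y j = 0) \<and> (\<forall>c\<in>C. (\<Sum>j<N. c j * y j) = 0)}"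

definition self_dual :: "nat \<Rightarrow> (nat \<Rightarrow> 'a::field) set \<Rightarrow> bool" where
  "self_dual N C \<longleftrightarrow> C = dual_code N C"

definition hamming_dist :: "nat \<Rightarrow> (nat \<Rightarrow> 'a) \<Rightarrow> (nat \<Rightarrow> 'a) \<Rightarrow> nat" where
  "hamming_dist N x y = card {j. j < N \<and> x j \<noteq> y j}"

definition min_dist :: "nat \<Rightarrow> (nat \<Rightarrow> 'a) set \<Rightarrow> nat" where
  "min_dist N C = Min {hamming_dist N x y | x y. x \<in> C \<and> y \<in> C \<and> x \<noteq> y}"

definition double_gen :: "nat \<Rightarrow> (nat \<Rightarrow> 'a::ring_1) \<Rightarrow> nat \<Rightarrow> nat \<Rightarrow> 'a" where
  "double_gen n h i j = (if j < n then id_mat i j else negacirc n h i (j - n))"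

definition double_negacirc_code :: "nat \<Rightarrow> (nat \<Rightarrow> 'a::field) \<Rightarrow> (nat \<Rightarrow> 'a) set" where
  "double_negacirc_code n h = gen_code n (2 * n) (double_gen n h)"

definition four_gen :: "nat \<Rightarrow> (nat \<Rightarrow> 'a::ring_1) \<Rightarrow> (nat \<Rightarrow> 'a) \<Rightarrow> nat \<Rightarrow> nat \<Rightarrow> 'a" where
  "four_gen n a b i j =
     (let A = negacirc n a; B = negacirc n b in
      if i < n then
        (if j < n then id_mat i j
         else if j < 2 * n then 0
         else if j < 3 * n then A i (j - 2 * n)
         else B i (j - 3 * n))
      else
        (let i' = i - n in
         if j < n then 0
         else if j < 2 * n then id_mat i' (j - n)
         else if j < 3 * n then - transp_mat B i' (j - 2 * n)
         else transp_mat A i' (j - 3 * n)))"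

definition four_negacirc_code :: "nat \<Rightarrow> (nat \<Rightarrow> 'a::field) \<Rightarrow> (nat \<Rightarrow> 'a) \<Rightarrow> (nat \<Rightarrow> 'a) set" where
  "four_negacirc_code n a b = gen_code (2 * n) (4 * n) (four_gen n a b)"

(* q-ary entropy; the paper defines it on [0,(q-1)/q); we extend by 1 beyond
   (the value of the continuous extension at (q-1)/q), and by 0 below 0 *)
definition Hq :: "nat \<Rightarrow> real \<Rightarrow> real" where
  "Hq q t = (if t \<le> 0 then 0
             else if t < (real q - 1) / real q then
               t * log q (real q - 1) - t * log q t - (1 - t) * log q (1 - t)
             else 1)"

definition rel_dist :: "nat set \<Rightarrow> (nat \<Rightarrow> nat) \<Rightarrow> (nat \<Rightarrow> (nat \<Rightarrow> 'a) set) \<Rightarrow> ereal" where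
  "rel_dist P len code =
     liminf (\<lambda>k. ereal (real (min_dist (len (enumerate P k)) (code (enumerate P k)))
                        / real (len (enumerate P k))))"

definition good_primes :: "nat \<Rightarrow> nat set" where
  "good_primes q = {p. prime p \<and> p mod 4 = 3 \<and> coprime p q \<and>
                       ord (4 * p) q = p - 1 \<and> ord p q mod 4 = 2}"

end

theory Submission
  imports Defs "HOL-Computational_Algebra.Polynomial_Factorial" "HOL-Algebra.Sylow"
    "HOL-Real_Asymp.Real_Asymp"
begin

text \<open>
  Write \<open>n = 2p\<close>, \<open>M = x\<^sup>n + 1\<close> and \<open>Q = q\<^bsup>(p-1)/2\<^esup>\<close>. The hypotheses on \<open>p\<close> give
  \<open>Q \<equiv> -1 (mod 4p)\<close>, so modulo \<open>M\<close> the conjugation \<open>x \<mapsto> x\<^sup>-\<^sup>1\<close>, which corresponds to transposing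
  negacirculant matrices, is the Frobenius power \<open>f \<mapsto> f\<^sup>Q\<close>. Hence \<open>C\<^sub>h\<close> is self-dual as soon as
  \<open>h\<^bsup>Q+1\<^esup> \<equiv> -1\<close>. One solution is \<open>h\<^sub>0 = \<alpha> + \<beta>x\<^sup>p\<close> with \<open>\<alpha>\<^sup>2 + \<beta>\<^sup>2 = -1\<close>; further ones are its
  Cayley twists \<open>h\<^sub>0 (1 - s) / (1 + s)\<close> by the skew elements \<open>s = c - c\<^sup>Q\<close>, where \<open>c\<close> runs through the
  \<open>q\<^sup>m\<close> polynomials of degree at most \<open>m = (p-3)/2\<close> without constant term.

  If a word \<open>(u, uh)\<close> lies in two codes of this family, then \<open>u g \<equiv> 0\<close> for a nonzero \<open>g\<close> of degree
  less than \<open>p - 1\<close>. All irreducible factors of \<open>M / (x\<^sup>2 + 1)\<close> have degree at least \<open>p - 1\<close>, so \<open>u\<close> is a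
  multiple of that polynomial and has weight at least \<open>p\<close>. Thus every lighter word lies in at most one
  of the codes, and as soon as the Hamming ball of radius \<open>d \<le> p\<close> in length \<open>4p\<close> has fewer than \<open>q\<^sup>m\<close>
  elements, one of them has minimum distance at least \<open>d\<close>. This gives entropy \<open>1/8\<close>.

  For the second part take \<open>a = h\<close> and \<open>b = 0\<close>: up to a permutation of the coordinates \<open>C\<^bsub>h,0\<^esub>\<close> is
  the direct sum of the codes of \<open>h\<close> and of its conjugate, which have the same minimum distance. The
  relative distance is halved, and \<open>H\<^sub>q(t/2) \<ge> H\<^sub>q(t)/2\<close> by concavity.
\<close>

hide_const (open) UnivPoly.monom UnivPoly.coeff module.smult

subsection \<open>Polynomials over finite fields\<close>

lemma power_card_eq_same:
  fixes x :: "'a::{finite,field}"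
  shows "x ^ CARD('a) = x"
proof (cases "x = 0")
  case True
  then show ?thesis by (simp add: zero_less_card_finite)
next
  case False
  have "x ^ (CARD('a) - 1) * \<Prod>(UNIV - {0}) = (\<Prod>y\<in>UNIV - {0}. x * y)"
    by (simp add: prod.distrib)
  also have "\<dots> = \<Prod>(UNIV - {0})"
    by (rule prod.reindex_bij_witness[of _ "\<lambda>y. y / x" "\<lambda>y. x * y"]) (use False in auto)
  finally have "x ^ (CARD('a) - 1) = 1"
    by simp
  then have "x * x ^ (CARD('a) - 1) = x" by simp
  then show ?thesis
    by (metis Suc_diff_1 power_Suc zero_less_card_finite)
qed

text \<open>For every prime \<open>r\<close> dividing the cardinality, Sylow's theorem with exponent
  1 gives an additive subgroup of order \<open>r\<close>. A nonzero \<open>x\<close> in it satisfies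
  \<open>r * x = 0\<close>, which forces \<open>r\<close> to be the characteristic.\<close>

lemma card_eq_CHAR_power: "\<exists>k. CARD('a::{finite,field}) = CHAR('a) ^ k"
proof -
  define G where "G = \<lparr>carrier = (UNIV :: 'a set), monoid.mult = (+), one = (0 :: 'a)\<rparr>"
  have G: "group G"
    by (rule groupI) (auto simp: G_def add.assoc intro: exI[of _ "- x" for x])
  have pow: "x [^]\<^bsub>G\<^esub> n = of_nat n * x" for x :: 'a and n :: nat
    by (induction n) (simp_all add: G_def nat_pow_def algebra_simps)
  have CHAR: "prime CHAR('a)"
    by (rule prime_CHAR_semidom) (simp add: finite_imp_CHAR_pos)
  have only: "r = CHAR('a)" if r: "prime r" "r dvd CARD('a)" for r
  proof -
    obtain m where "CARD('a) = r ^ 1 * m" using r by auto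
    then have "order G = r ^ 1 * m" by (simp add: order_def G_def)
    then obtain H where H: "subgroup H G" "card H = r ^ 1"
      using sylow_thm[OF r(1) G, of 1 m] by (auto simp: G_def)
    then have "card H > 1" using r prime_gt_1_nat by auto
    then have "\<not> H \<subseteq> {0}"
      by (metis card_mono finite.emptyI finite.insertI is_singletonI is_singleton_altdef leD)
    then obtain x where x: "x \<in> H" "x \<noteq> 0" by auto
    interpret H: group "G\<lparr>carrier := H\<rparr>"
      using H G subgroup.subgroup_is_group by blast
    have "x [^]\<^bsub>G\<lparr>carrier := H\<rparr>\<^esub> order (G\<lparr>carrier := H\<rparr>) = \<one>\<^bsub>G\<lparr>carrier := H\<rparr>\<^esub>"
      using x by (intro H.pow_order_eq_1) auto
    then have "of_nat r * x = 0"
      using pow[of x r] H by (simp add: order_def G_def nat_pow_def)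
    then have "of_nat r = (0::'a)" using x by simp
    then have "CHAR('a) dvd r" by (simp add: of_nat_eq_0_iff_char_dvd)
    then show ?thesis using primes_dvd_imp_eq[OF CHAR r(1)] by simp
  qed
  have "CARD('a) = (\<Prod>r\<in>prime_factors CARD('a). r ^ multiplicity r CARD('a))"
    by (subst prime_factorization_nat) (auto simp: zero_less_card_finite)
  also have "prime_factors CARD('a) \<subseteq> {CHAR('a)}"
    using only by (auto simp: prime_factors_dvd)
  then consider "prime_factors CARD('a) = {}" | "prime_factors CARD('a) = {CHAR('a)}" by blast
  then have "\<exists>k. (\<Prod>r\<in>prime_factors CARD('a). r ^ multiplicity r CARD('a)) = CHAR('a) ^ k"
    by cases (auto intro: exI[of _ 0])
  finally show ?thesis .
qed

text \<open>\<open>CARD('a) ^ e\<close> is a power of the characteristic, so raising to it is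
  additive, and it fixes every coefficient since elements of the field satisfy
  \<open>x ^ CARD('a) = x\<close>.\<close>

lemma poly_frobenius:
  fixes a :: "nat \<Rightarrow> 'a::{finite,field}"
  shows "(\<Sum>i\<in>A. monom (a i) i) ^ (CARD('a) ^ e) = (\<Sum>i\<in>A. monom (a i) (i * CARD('a) ^ e))"
proof -
  obtain k where k: "CARD('a) = CHAR('a) ^ k" using card_eq_CHAR_power by blast
  have CHAR: "prime CHAR('a poly)"
    unfolding semiring_char_poly by (rule prime_CHAR_semidom) (simp add: finite_imp_CHAR_pos)
  have pow: "x ^ (CARD('a) ^ e) = x" for x :: 'a
    by (induction e) (simp_all add: power_mult power_card_eq_same)
  have "(\<Sum>i\<in>A. monom (a i) i) ^ (CARD('a) ^ e) = (\<Sum>i\<in>A. monom (a i) i ^ (CARD('a) ^ e))"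
    by (rule freshmans_dream_sum'[OF CHAR, of _ "k * e"]) (simp add: k power_mult)
  then show ?thesis by (simp add: monom_power pow mult.commute)
qed

lemma poly_frobenius_add:
  fixes f g :: "'a::{finite,field} poly"
  shows "(f + g) ^ (CARD('a) ^ e) = f ^ (CARD('a) ^ e) + g ^ (CARD('a) ^ e)"
proof -
  obtain k where k: "CARD('a) = CHAR('a) ^ k" using card_eq_CHAR_power by blast
  have CHAR: "prime CHAR('a poly)"
    unfolding semiring_char_poly by (rule prime_CHAR_semidom) (simp add: finite_imp_CHAR_pos)
  show ?thesis
    by (rule freshmans_dream'[OF CHAR, of _ "k * e"]) (simp add: k power_mult)
qed

lemma poly_frobenius_diff:
  fixes f g :: "'a::{finite,field} poly"
  shows "(f - g) ^ (CARD('a) ^ e) = f ^ (CARD('a) ^ e) - g ^ (CARD('a) ^ e)"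
  using poly_frobenius_add[of "f - g" g e] by simp

text \<open>Pigeonhole: squaring is at most two-to-one and the cardinality is odd, so more than half
  of all elements are squares. Hence the set of squares meets its reflection
  \<open>y \<mapsto> c - y\<close>.\<close>

lemma sum_two_squares:
  fixes c :: "'a::{finite,field}"
  assumes "odd CARD('a)"
  shows "\<exists>a b. a\<^sup>2 + b\<^sup>2 = c"
proof -
  define S :: "'a set" where "S = range (\<lambda>x. x\<^sup>2)"
  have fib: "card {x::'a. x\<^sup>2 = y} \<le> 2" for y
  proof (cases "\<exists>z. z\<^sup>2 = y")
    case True
    then obtain z where "z\<^sup>2 = y" ..
    then have "{x::'a. x\<^sup>2 = y} \<subseteq> {z, - z}" by (auto simp: power2_eq_iff)
    then have "card {x::'a. x\<^sup>2 = y} \<le> card {z, - z}" by (intro card_mono) auto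
    also have "\<dots> \<le> 2" by (simp add: card_insert_if)
    finally show ?thesis .
  qed auto
  have "CARD('a) = card (\<Union>y\<in>S. {x::'a. x\<^sup>2 = y})"
    by (rule arg_cong[where f = card]) (auto simp: S_def)
  also have "\<dots> \<le> (\<Sum>y\<in>S. card {x::'a. x\<^sup>2 = y})"
    by (rule card_UN_le) auto
  also have "\<dots> \<le> (\<Sum>y\<in>S. 2)" by (rule sum_mono) (rule fib)
  finally have "CARD('a) \<le> 2 * card S" by simp
  then have S: "CARD('a) < 2 * card S" using assms by (metis dvd_triv_left le_neq_implies_less)
  have "S \<inter> (\<lambda>y. c - y) ` S \<noteq> {}"
  proof
    assume "S \<inter> (\<lambda>y. c - y) ` S = {}"
    then have "card (S \<union> (\<lambda>y. c - y) ` S) = card S + card ((\<lambda>y. c - y) ` S)"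
      by (intro card_Un_disjoint) auto
    also have "card ((\<lambda>y. c - y) ` S) = card S"
      by (intro card_image) (auto simp: inj_on_def)
    finally have "card S + card S \<le> CARD('a)" by (metis card_mono finite subset_UNIV)
    then show False using S by simp
  qed
  then obtain a b where "a\<^sup>2 = c - b\<^sup>2" by (auto simp: S_def)
  then show ?thesis by (auto simp: algebra_simps)
qed

section \<open>Counting residues and factoring polynomials over a finite field\<close>

lemma card_polys_degree_less:
  fixes d :: nat
  shows "finite {f::'a::{finite,field} poly. \<forall>i\<ge>d. coeff f i = 0}"
    and "card {f::'a poly. \<forall>i\<ge>d. coeff f i = 0} = CARD('a) ^ d"
proof -
  define to_poly :: "(nat \<Rightarrow> 'a) \<Rightarrow> 'a poly" where "to_poly g = (\<Sum>i<d. monom (g i) i)" for g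
  have coeff: "coeff (to_poly g) i = (if i < d then g i else 0)" for g i
    by (simp add: to_poly_def coeff_sum sum.delta)
  have "bij_betw to_poly ({..<d} \<rightarrow>\<^sub>E UNIV) {f. \<forall>i\<ge>d. coeff f i = 0}"
    by (rule bij_betw_byWitness[where f' = "\<lambda>f. restrict (coeff f) {..<d}"])
       (auto simp: coeff poly_eq_iff fun_eq_iff PiE_def extensional_def)
  then show "finite {f::'a poly. \<forall>i\<ge>d. coeff f i = 0}"
    and "card {f::'a poly. \<forall>i\<ge>d. coeff f i = 0} = CARD('a) ^ d"
    by (auto simp: bij_betw_finite[symmetric] bij_betw_same_card[symmetric] card_PiE
          intro!: finite_PiE)
qed

text \<open>Fermat's argument modulo \<open>f\<close>: multiplication by x permutes the nonzero
  residues, represented in \<open>N\<close> by polynomials of degree below \<open>degree f\<close>.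
  Comparing the product over \<open>N\<close> before and after, and cancelling it, gives the
  claim.\<close>

lemma irreducible_dvd_power_card:
  fixes f :: "'a::{finite,field} poly"
  assumes f: "irreducible f" and x: "\<not> f dvd monom 1 1"
  shows "f dvd monom 1 1 ^ (CARD('a) ^ degree f - 1) - 1"
proof -
  define d where "d = degree f"
  define N where "N = {r::'a poly. \<forall>i\<ge>d. coeff r i = 0} - {0}"
  have f0: "f \<noteq> 0" and prime: "prime_elem f"
    using f field_poly_irreducible_imp_prime by auto
  have d0: "d > 0"
    using f f0 by (auto simp: d_def irreducible_def is_unit_iff_degree)
  have fin: "finite N" using card_polys_degree_less by (simp add: N_def)
  have card: "card N = CARD('a) ^ d - 1"
    by (simp add: N_def card_polys_degree_less)
  have N_iff: "r \<in> N \<longleftrightarrow> r \<noteq> 0 \<and> degree r < d" for r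
    using d0 by (auto simp: N_def coeff_eq_0 intro: ccontr)
      (metis d0 leading_coeff_0_iff not_le)
  have ndvd: "\<not> f dvd r" if "r \<in> N" for r
    using that by (auto simp: N_iff d_def dest: dvd_imp_degree_le)
  have inj: "inj_on (\<lambda>r. (monom 1 1 * r) mod f) N"
  proof (rule inj_onI)
    fix r s assume rs: "r \<in> N" "s \<in> N" "(monom 1 1 * r) mod f = (monom 1 1 * s) mod f"
    then have "f dvd monom 1 1 * (r - s)"
      by (simp add: mod_eq_dvd_iff right_diff_distrib)
    then have dvd: "f dvd r - s" using prime x by (simp add: prime_elem_dvd_mult_iff)
    show "r = s"
    proof (rule ccontr)
      assume "r \<noteq> s"
      then have "d \<le> degree (r - s)" using dvd by (simp add: d_def dvd_imp_degree_le)
      moreover have "degree (r - s) < d"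
        using rs by (intro degree_diff_less) (auto simp: N_iff)
      ultimately show False by simp
    qed
  qed
  have into: "(\<lambda>r. (monom 1 1 * r) mod f) ` N \<subseteq> N"
  proof safe
    fix r assume "r \<in> N"
    then have "\<not> f dvd monom 1 1 * r" using prime x ndvd by (simp add: prime_elem_dvd_mult_iff)
    then have "(monom 1 1 * r) mod f \<noteq> 0" by (simp add: dvd_eq_mod_eq_0)
    then show "(monom 1 1 * r) mod f \<in> N"
      using degree_mod_less'[OF f0] by (simp add: N_iff d_def)
  qed
  have bij: "bij_betw (\<lambda>r. (monom 1 1 * r) mod f) N N"
    using inj into fin by (simp add: bij_betw_def endo_inj_surj)
  have "[\<Prod>N = (\<Prod>r\<in>N. monom 1 1 * r)] (mod f)"
    unfolding prod.reindex_bij_betw[OF bij, symmetric, of "\<lambda>r. r"]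
    by (rule cong_prod) simp
  also have "(\<Prod>r\<in>N. monom 1 1 * r) = monom 1 1 ^ card N * \<Prod>N"
    by (simp add: prod.distrib)
  finally have "f dvd monom 1 1 ^ card N * \<Prod>N - \<Prod>N"
    by (metis cong_iff_dvd_diff cong_sym)
  then have "f dvd (monom 1 1 ^ card N - 1) * \<Prod>N"
    by (simp add: left_diff_distrib)
  moreover have "\<not> f dvd \<Prod>N"
    using fin ndvd
  proof (induction N rule: finite_induct)
    case empty
    then show ?case using f by (simp add: irreducible_def)
  next
    case (insert r N)
    then show ?case using prime by (auto simp: prime_elem_dvd_mult_iff)
  qed
  ultimately show ?thesis
    using prime by (simp add: prime_elem_dvd_mult_iff card d_def)
qed

lemma irreducible_factor_exists:
  fixes f :: "'a::field poly"
  assumes "degree f > 0"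
  shows "\<exists>g. irreducible g \<and> g dvd f"
  using assms
proof (induction "degree f" arbitrary: f rule: less_induct)
  case less
  show ?case
  proof (cases "irreducible f")
    case True
    then show ?thesis by auto
  next
    case False
    have "f \<noteq> 0" using less.prems by auto
    then have f0: "f \<noteq> 0" "\<not> is_unit f" using less.prems by (simp_all add: is_unit_iff_degree)
    then obtain a b where ab: "f = a * b" "\<not> is_unit a" "\<not> is_unit b"
      using False unfolding irreducible_def by blast
    then have nz: "a \<noteq> 0" "b \<noteq> 0" using f0 by auto
    then have "degree a > 0" "degree b > 0" using ab(2,3) by (simp_all add: is_unit_iff_degree)
    then obtain g where "irreducible g" "g dvd a"
      using less.hyps[of a] by (auto simp: \<open>f = a * b\<close> degree_mult_eq[OF nz])
    then show ?thesis using dvd_mult2[of g a b] by (auto simp: \<open>f = a * b\<close>)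
  qed
qed

text \<open>Irreducible factors of \<open>P\<close> are split off one at a time: each is too large
  to divide \<open>g\<close>, so it divides \<open>u\<close>, and it is cancelled from both
  \<open>P\<close> and \<open>u\<close> before the induction continues.\<close>

lemma dvd_of_dvd_mult_small_degree:
  fixes P u g :: "'a::field poly"
  assumes "\<And>f. irreducible f \<Longrightarrow> f dvd P \<Longrightarrow> degree g < degree f"
    and "P \<noteq> 0" "g \<noteq> 0" "P dvd u * g"
  shows "P dvd u"
  using assms
proof (induction "degree P" arbitrary: P u rule: less_induct)
  case less
  show ?case
  proof (cases "degree P = 0")
    case True
    then have "is_unit P" using less.prems(2) by (simp add: is_unit_iff_degree)
    then show ?thesis by (rule unit_imp_dvd)
  next
    case False
    then obtain f where f: "irreducible f" "f dvd P" using irreducible_factor_exists by blast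
    then obtain P' where P': "P = f * P'" by auto
    have prime: "prime_elem f" using f field_poly_irreducible_imp_prime by auto
    have "f dvd u * g" using f(2) less.prems(4) by (rule dvd_trans)
    moreover have "\<not> f dvd g" using less.prems(1)[OF f] less.prems(3) by (auto dest: dvd_imp_degree_le)
    ultimately have "f dvd u" using prime by (simp add: prime_elem_dvd_mult_iff)
    then obtain u' where u': "u = f * u'" by auto
    have f0: "f \<noteq> 0" "P' \<noteq> 0" using less.prems(2) P' by auto
    have dvd': "P' dvd u' * g" using less.prems(4) f0(1) by (simp add: P' u' mult.assoc)
    have f_pos: "degree f > 0" using f(1) f0(1) by (simp add: irreducible_def is_unit_iff_degree)
    have "P' dvd u'"
    proof (rule less.hyps)
      show "degree P' < degree P" using f_pos f0 by (simp add: P' degree_mult_eq)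
      show "degree g < degree f'" if "irreducible f'" "f' dvd P'" for f'
        using less.prems(1) that by (simp add: P')
    qed (use f0(2) less.prems(3) dvd' in auto)
    then show ?thesis by (simp add: P' u')
  qed
qed

subsection \<open>Negacirculant matrices and self-duality\<close>

definition vec_poly :: "nat \<Rightarrow> (nat \<Rightarrow> 'a::comm_ring_1) \<Rightarrow> 'a poly" where
  "vec_poly n u = (\<Sum>i<n. monom (u i) i)"

definition nega_modulus :: "nat \<Rightarrow> 'a::comm_ring_1 poly" where
  "nega_modulus n = monom 1 n + 1"

definition vec_negacirc :: "nat \<Rightarrow> (nat \<Rightarrow> 'a::comm_ring_1) \<Rightarrow> (nat \<Rightarrow> 'a) \<Rightarrow> nat \<Rightarrow> 'a" where
  "vec_negacirc n u h j = (\<Sum>i<n. u i * negacirc n h i j)"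

text \<open>The first column of the negacirculant matrix, hence the first row of its transpose. In
  the quotient ring it represents h(1/x), since x^(-i) = -x^(n-i).\<close>

definition nega_conj :: "nat \<Rightarrow> (nat \<Rightarrow> 'a::ring_1) \<Rightarrow> nat \<Rightarrow> 'a" where
  "nega_conj n h i = negacirc n h i 0"

lemma negacirc_transpose:
  assumes "i < n" "j < n"
  shows "negacirc n h j i = negacirc n (nega_conj n h) i j"
  using assms by (auto simp: negacirc_def nega_conj_def)

lemma coeff_vec_poly: "coeff (vec_poly n u) j = (if j < n then u j else 0)"
  by (simp add: vec_poly_def coeff_sum sum.delta)

lemma vec_poly_coeff:
  assumes "\<And>i. i \<ge> n \<Longrightarrow> coeff f i = 0"
  shows "vec_poly n (coeff f) = f"
  using assms by (auto simp: poly_eq_iff coeff_vec_poly)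

lemma vec_poly_uminus: "vec_poly n (\<lambda>i. - u i) = - vec_poly n u"
  by (simp add: poly_eq_iff coeff_vec_poly)

lemma degree_nega_modulus:
  assumes "n > 0"
  shows "degree (nega_modulus n :: 'a::comm_ring_1 poly) = n"
    and "nega_modulus n \<noteq> (0 :: 'a::comm_ring_1 poly)"
proof -
  show "degree (nega_modulus n :: 'a poly) = n"
    unfolding nega_modulus_def using assms
    by (subst degree_add_eq_left) (simp_all add: degree_monom_eq)
  then show "nega_modulus n \<noteq> (0 :: 'a::comm_ring_1 poly)" using assms by auto
qed

lemma degree_vec_poly:
  assumes "n > 0" shows "degree (vec_poly n u) < n"
  using assms by (intro degree_lessI) (simp_all add: coeff_vec_poly)

lemma vec_poly_cong_imp_eq:
  fixes u v :: "nat \<Rightarrow> 'a::field"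
  assumes "[vec_poly n u = vec_poly n v] (mod nega_modulus n)" "j < n"
  shows "u j = v j"
proof -
  have n: "n > 0" using assms(2) by simp
  have "vec_poly n u = vec_poly n v"
    using assms(1) degree_vec_poly[OF n, of u] degree_vec_poly[OF n, of v]
    by (simp add: cong_def mod_poly_less degree_nega_modulus n)
  then show ?thesis using assms(2) by (metis coeff_vec_poly)
qed

lemma monom_wrap_cong:
  fixes c :: "'a::field"
  shows "[monom c (i + n) = monom (- c) i] (mod nega_modulus n)"
proof -
  have "monom c (i + n) - monom (- c) i = monom c i * nega_modulus n"
    by (simp add: nega_modulus_def distrib_left mult_monom minus_monom[symmetric])
  then show ?thesis by (simp add: cong_iff_dvd_diff)
qed

text \<open>Multiplication by x is the negashift: an exponent that passes \<open>n\<close> wraps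
  around with a change of sign.\<close>

lemma vec_poly_row_cong:
  fixes h :: "nat \<Rightarrow> 'a::field"
  assumes "i < n"
  shows "[vec_poly n (negacirc n h i) = monom 1 i * vec_poly n h] (mod nega_modulus n)"
proof -
  have "monom 1 i * vec_poly n h = (\<Sum>k<n. monom (h k) (i + k))"
    by (simp add: vec_poly_def sum_distrib_left mult_monom)
  also have "[\<dots> = (\<Sum>k<n. if i + k < n then monom (h k) (i + k) else monom (- h k) (i + k - n))]
      (mod nega_modulus n)"
  proof (rule cong_sum)
    fix k
    show "[monom (h k) (i + k) = (if i + k < n then monom (h k) (i + k) else monom (- h k) (i + k - n))]
      (mod nega_modulus n)"
      using monom_wrap_cong[of "h k" "i + k - n" n] by (cases "i + k < n") simp_all
  qed
  also have "(\<Sum>k<n. if i + k < n then monom (h k) (i + k) else monom (- h k) (i + k - n)) =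
      (\<Sum>j<n. monom (negacirc n h i j) j)"
    by (rule sum.reindex_bij_witness[of _ "\<lambda>j. if i \<le> j then j - i else n + j - i"
          "\<lambda>k. if i + k < n then i + k else i + k - n"])
       (use assms in \<open>auto simp: negacirc_def\<close>)
  finally show ?thesis by (simp add: vec_poly_def cong_sym)
qed

lemma const_poly_mult_monom: "[:c:] * monom a j = monom (c * a) j"
  by (simp add: smult_monom)

lemma vec_poly_vec_negacirc:
  fixes u h :: "nat \<Rightarrow> 'a::field"
  shows "[vec_poly n (vec_negacirc n u h) = vec_poly n u * vec_poly n h] (mod nega_modulus n)"
proof -
  have "vec_poly n (vec_negacirc n u h) = (\<Sum>j<n. \<Sum>i<n. [:u i:] * monom (negacirc n h i j) j)"
    unfolding vec_poly_def vec_negacirc_def monom_sum const_poly_mult_monom ..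
  also have "\<dots> = (\<Sum>i<n. [:u i:] * vec_poly n (negacirc n h i))"
    unfolding vec_poly_def sum_distrib_left by (rule sum.swap)
  also have "[\<dots> = (\<Sum>i<n. [:u i:] * (monom 1 i * vec_poly n h))] (mod nega_modulus n)"
    by (intro cong_sum cong_scalar_left vec_poly_row_cong) simp
  also have "(\<Sum>i<n. [:u i:] * (monom 1 i * vec_poly n h)) = vec_poly n u * vec_poly n h"
    unfolding mult.assoc[symmetric] const_poly_mult_monom vec_poly_def[of n u] sum_distrib_right
    by simp
  finally show ?thesis .
qed

text \<open>The polynomial form of the matrix identity H H^t = -I.\<close>

definition nega_unitary :: "nat \<Rightarrow> (nat \<Rightarrow> 'a::field) \<Rightarrow> bool" where
  "nega_unitary n h \<longleftrightarrow>
     [vec_poly n h * vec_poly n (nega_conj n h) = - 1] (mod nega_modulus n)"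

lemma vec_negacirc_cong:
  "(\<And>i. i < n \<Longrightarrow> u i = v i) \<Longrightarrow> vec_negacirc n u h = vec_negacirc n v h"
  by (auto simp: vec_negacirc_def intro!: sum.cong)

lemma vec_negacirc_mult_minus_one:
  assumes "[vec_poly n h * vec_poly n k = - 1] (mod nega_modulus n)" "j < n"
  shows "vec_negacirc n (vec_negacirc n u h) k j = - u j"
proof -
  have "[vec_poly n (vec_negacirc n (vec_negacirc n u h) k)
      = vec_poly n (vec_negacirc n u h) * vec_poly n k] (mod nega_modulus n)"
    by (rule vec_poly_vec_negacirc)
  also have "[vec_poly n (vec_negacirc n u h) * vec_poly n k
      = vec_poly n u * vec_poly n h * vec_poly n k] (mod nega_modulus n)"
    by (intro cong_scalar_right vec_poly_vec_negacirc)
  also have "vec_poly n u * vec_poly n h * vec_poly n k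
      = vec_poly n u * (vec_poly n h * vec_poly n k)" by (simp add: mult.assoc)
  also have "[\<dots> = vec_poly n u * - 1] (mod nega_modulus n)"
    by (intro cong_scalar_left assms)
  also have "vec_poly n u * - 1 = vec_poly n (\<lambda>i. - u i)" by (simp add: vec_poly_uminus)
  finally show ?thesis by (rule vec_poly_cong_imp_eq) fact
qed

lemma nega_conj_conj:
  assumes "i < n" shows "nega_conj n (nega_conj n h) i = h i"
  using assms by (auto simp: nega_conj_def negacirc_def)

lemma vec_poly_cong: "(\<And>i. i < n \<Longrightarrow> u i = v i) \<Longrightarrow> vec_poly n u = vec_poly n v"
  by (simp add: poly_eq_iff coeff_vec_poly)

lemma nega_unitary_conj:
  assumes "nega_unitary n h" shows "nega_unitary n (nega_conj n h)"
proof -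
  have "vec_poly n (nega_conj n (nega_conj n h)) = vec_poly n h"
    by (rule vec_poly_cong) (rule nega_conj_conj)
  then show ?thesis using assms unfolding nega_unitary_def by (simp only: mult.commute)
qed

lemma nega_unitary_inverse:
  assumes "nega_unitary n h" "j < n"
  shows "vec_negacirc n (vec_negacirc n u h) (nega_conj n h) j = - u j"
    and "vec_negacirc n (vec_negacirc n u (nega_conj n h)) h j = - u j"
proof -
  have 1: "[vec_poly n h * vec_poly n (nega_conj n h) = - 1] (mod nega_modulus n)"
    using assms(1) unfolding nega_unitary_def .
  show "vec_negacirc n (vec_negacirc n u h) (nega_conj n h) j = - u j"
    using 1 assms(2) by (rule vec_negacirc_mult_minus_one)
  show "vec_negacirc n (vec_negacirc n u (nega_conj n h)) h j = - u j"
    using 1[unfolded mult.commute[of "vec_poly n h"]] assms(2) by (rule vec_negacirc_mult_minus_one)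
qed

lemma vec_negacirc_uminus: "vec_negacirc n (\<lambda>i. - u i) h j = - vec_negacirc n u h j"
  by (simp add: vec_negacirc_def sum_negf)

lemma vec_negacirc_diff:
  "vec_negacirc n (\<lambda>i. u i - v i) h j = vec_negacirc n u h j - vec_negacirc n v h j"
  by (simp add: vec_negacirc_def sum_subtractf left_diff_distrib)

text \<open>The adjoint of multiplication by H is multiplication by its transpose, the matrix of
  \<open>nega_conj n h\<close>.\<close>

lemma vec_negacirc_adjoint:
  "(\<Sum>j<n. vec_negacirc n u h j * v j) = (\<Sum>i<n. u i * vec_negacirc n v (nega_conj n h) i)"
proof -
  have "(\<Sum>j<n. vec_negacirc n u h j * v j) = (\<Sum>j<n. \<Sum>i<n. u i * (v j * negacirc n h i j))"
    unfolding vec_negacirc_def sum_distrib_right by (intro sum.cong refl) (simp only: mult_ac)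
  also have "\<dots> = (\<Sum>i<n. \<Sum>j<n. u i * (v j * negacirc n (nega_conj n h) j i))"
  proof (subst sum.swap, intro sum.cong refl)
    fix i j assume "i \<in> {..<n}" "j \<in> {..<n}"
    then show "u i * (v j * negacirc n h i j) = u i * (v j * negacirc n (nega_conj n h) j i)"
      using negacirc_transpose[of j n i h] by simp
  qed
  finally show ?thesis unfolding vec_negacirc_def sum_distrib_left .
qed

section \<open>Codewords and duals of double-negacirculant codes\<close>

definition double_word :: "nat \<Rightarrow> (nat \<Rightarrow> 'a::field) \<Rightarrow> (nat \<Rightarrow> 'a) \<Rightarrow> nat \<Rightarrow> 'a" where
  "double_word n h u j = (if j < n then u j else if j < 2 * n then vec_negacirc n u h (j - n) else 0)"

lemma double_negacirc_code_eq: "double_negacirc_code n h = range (double_word n h)"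
proof -
  have "(\<lambda>j. if j < 2 * n then \<Sum>i<n. u i * double_gen n h i j else 0) = double_word n h u" for u
  proof
    fix j
    have "(\<Sum>i<n. u i * id_mat i j) = u j" if "j < n"
      using that by (simp add: id_mat_def sum.delta if_distrib cong: if_cong)
    then show "(if j < 2 * n then \<Sum>i<n. u i * double_gen n h i j else 0) = double_word n h u j"
      by (auto simp: double_word_def double_gen_def vec_negacirc_def)
  qed
  then show ?thesis by (auto simp: double_negacirc_code_def gen_code_def)
qed

lemma sum_split_double:
  fixes f :: "nat \<Rightarrow> 'a::comm_monoid_add"
  shows "(\<Sum>j<2 * n. f j) = (\<Sum>j<n. f j) + (\<Sum>j<n. f (n + j))"
proof -
  have "(\<Sum>j<n + m. f j) = (\<Sum>j<n. f j) + (\<Sum>j<m. f (n + j))" for m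
    by (induction m) (simp_all add: add.assoc)
  then show ?thesis by (simp add: mult_2)
qed

text \<open>A word (y1, y2) is orthogonal to all (u, uH) iff y1 = -y2 H^t. Because H H^t = H^t H =
  -I, this is equivalent to y2 = y1 H, which is membership in the code.\<close>

lemma self_dual_double:
  assumes h: "nega_unitary n h"
  shows "self_dual (2 * n) (double_negacirc_code n h)"
proof -
  let ?h' = "nega_conj n h"
  have inner: "(\<Sum>j<2 * n. double_word n h u j * y j) =
      (\<Sum>j<n. u j * (y j + vec_negacirc n (\<lambda>j. y (n + j)) ?h' j))" for u y
    by (simp add: sum_split_double double_word_def vec_negacirc_adjoint distrib_left sum.distrib)
  show ?thesis
    unfolding self_dual_def dual_code_def double_negacirc_code_eq
  proof (intro equalityI subsetI)
    fix y assume "y \<in> range (double_word n h)"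
    then obtain v where y: "y = double_word n h v" by auto
    have "vec_negacirc n (\<lambda>j. y (n + j)) ?h' j = - v j" if "j < n" for j
    proof -
      have "vec_negacirc n (\<lambda>j. y (n + j)) ?h' = vec_negacirc n (vec_negacirc n v h) ?h'"
        by (rule vec_negacirc_cong) (simp add: y double_word_def)
      then show ?thesis using nega_unitary_inverse(1)[OF h that] by simp
    qed
    then have "(\<Sum>j<2 * n. double_word n h u j * y j) = 0" for u
      unfolding inner by (intro sum.neutral) (simp add: y double_word_def)
    then show "y \<in> {y. (\<forall>j\<ge>2 * n. y j = 0) \<and>
        (\<forall>c\<in>range (double_word n h). (\<Sum>j<2 * n. c j * y j) = 0)}"
      by (auto simp: y double_word_def)
  next
    fix y assume "y \<in> {y. (\<forall>j\<ge>2 * n. y j = 0) \<and>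
        (\<forall>c\<in>range (double_word n h). (\<Sum>j<2 * n. c j * y j) = 0)}"
    then have supp: "\<And>j. j \<ge> 2 * n \<Longrightarrow> y j = 0"
      and orth: "\<And>u. (\<Sum>j<2 * n. double_word n h u j * y j) = 0" by auto
    \<comment> \<open>Orthogonality is tested against the codeword of the \<open>j\<close>-th unit
      vector.\<close>
    have y1: "y j = - vec_negacirc n (\<lambda>j. y (n + j)) ?h' j" if "j < n" for j
      using orth[of "\<lambda>i. if i = j then 1 else 0"] that
      by (simp add: inner if_distrib[of "\<lambda>x. x * _"] sum.delta eq_neg_iff_add_eq_0 cong: if_cong)
    have y2: "vec_negacirc n y h j = y (n + j)" if "j < n" for j
    proof -
      have "vec_negacirc n y h j
          = vec_negacirc n (\<lambda>j. - vec_negacirc n (\<lambda>j. y (n + j)) ?h' j) h j"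
        by (rule fun_cong[OF vec_negacirc_cong]) (rule y1)
      also have "\<dots> = y (n + j)"
        using nega_unitary_inverse(2)[OF h that] by (simp add: vec_negacirc_uminus)
      finally show ?thesis .
    qed
    have "double_word n h y = y"
    proof
      fix j show "double_word n h y j = y j"
        using y2[of "j - n"] supp[of j] by (auto simp: double_word_def)
    qed
    then show "y \<in> range (double_word n h)" by (metis rangeI)
  qed
qed

subsection \<open>Unitary elements modulo \<open>x\<^sup>n + 1\<close>\<close>

text \<open>Put k = (p-1)/2, which is odd. Modulo 4, q is -1 and so is q^k. Modulo p, q^k is a
  square root of 1 and differs from 1 because the order of q exceeds k, so it is -1 as well.\<close>

lemma good_primes_dvd:
  assumes p: "p \<in> good_primes q" and q: "q mod 4 = 3"
  shows "4 * p dvd q ^ ((p - 1) div 2) + 1"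
proof -
  have pp: "prime p" "p mod 4 = 3" "coprime p q" "ord (4 * p) q = p - 1" "ord p q mod 4 = 2"
    using p by (auto simp: good_primes_def)
  define k where "k = (p - 1) div 2"
  have k: "p - 1 = 2 * k" "odd k" "k > 0"
    using pp(2) unfolding k_def by presburger+
  have "odd p" using pp(2) by presburger
  then have "coprime (2 ^ 2) p" unfolding coprime_power_left_iff by simp
  then have c4p: "coprime 4 p" by simp
  have q4: "[q = 3] (mod 4)" using q by (simp add: cong_def)
  have three: "[3 ^ e = (if even e then 1 else 3)] (mod (4::nat))" for e
  proof (induction e)
    case (Suc e)
    then have "[3 * 3 ^ e = 3 * (if even e then 1 else 3)] (mod (4::nat))" by (rule cong_scalar_left)
    also have "[3 * (if even e then 1 else 3) = (if even (Suc e) then 1 else 3)] (mod (4::nat))"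
      by (simp add: cong_def)
    finally show ?case by simp
  qed simp
  have q4e: "[q ^ e = (if even e then 1 else 3)] (mod 4)" for e
    using cong_trans[OF cong_pow[OF q4] three] .
  have "even (ord p q)" using pp(5) by presburger
  then have "[q ^ ord p q = 1] (mod 4)" using q4e[of "ord p q"] by simp
  moreover have "[q ^ ord p q = 1] (mod p)" by (rule ord)
  ultimately have "[q ^ ord p q = 1] (mod (4 * p))" using c4p by (rule coprime_cong_mult_nat)
  then have "p - 1 dvd ord p q" using pp(4) ord_divides[of q "ord p q" "4 * p"] by simp
  \<comment> \<open>The condition \<open>ord p q mod 4 = 2\<close> excludes the value 0, so
    divisibility by \<open>p - 1 = 2 * k\<close> yields a lower bound.\<close>
  then have ordp: "k < ord p q" using k pp(5) by (metis dvd_imp_le mod_0 mult_2 less_add_same_cancel1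
        not_gr_zero numeral_eq_iff order_less_le_trans zero_neq_numeral)
  have qk: "[q ^ k \<noteq> 1] (mod p)" using ord_minimal[OF k(3) ordp] .
  have "[(q ^ k) ^ 2 = 1] (mod p)"
  proof -
    have "[q ^ (p - 1) = 1] (mod (4 * p))" using ord[of q "4 * p"] pp(4) by simp
    then have "[q ^ (p - 1) = 1] (mod p)" by (rule cong_dvd_mono_modulus) simp
    then show ?thesis by (simp only: k(1) power_mult mult.commute[of 2])
  qed
  then have "[int (q ^ k) ^ 2 = 1] (mod (int p))"
    by (metis cong_int_iff of_nat_1 of_nat_power)
  then have "int p dvd (int (q ^ k) - 1) * (int (q ^ k) + 1)"
    by (simp add: cong_iff_dvd_diff power2_eq_square algebra_simps)
  moreover have "\<not> int p dvd int (q ^ k) - 1"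
    using qk by (metis cong_iff_dvd_diff cong_int_iff of_nat_1)
  moreover have "prime (int p)" using pp by simp
  ultimately have "int p dvd int (q ^ k) + 1" using prime_dvd_mult_iff by blast
  then have "p dvd q ^ k + 1" by (metis int_dvd_int_iff of_nat_1 of_nat_add)
  moreover have "4 dvd q ^ k + 1"
    using q4e[of k] k(2) by (simp add: cong_def) presburger
  ultimately show ?thesis unfolding k_def using c4p by (intro divides_mult) auto
qed

section \<open>Powers of x and conjugation as a Frobenius power\<close>

abbreviation "X \<equiv> monom 1 1"

lemma monom_eq_X_power: "monom c i = [:c:] * X ^ i"
  by (simp add: monom_power smult_monom)

lemma X_power_n_cong: "[X ^ n = - 1] (mod nega_modulus n :: 'a::field poly)"
  by (simp add: nega_modulus_def cong_iff_dvd_diff monom_power)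

lemma X_power_cong:
  assumes "2 * n dvd j"
  shows "[X ^ j = 1] (mod nega_modulus n :: 'a::field poly)"
proof -
  obtain k where "j = 2 * n * k" using assms ..
  then have j: "j = n * (2 * k)" by simp
  have "[(X ^ n) ^ (2 * k) = (- 1) ^ (2 * k)] (mod nega_modulus n :: 'a::field poly)"
    by (intro cong_pow X_power_n_cong)
  then show ?thesis by (simp add: j power_mult)
qed

text \<open>Since x^(2n) = 1 and Q is -1 modulo 2n, x^(iQ) is x^(-i), written with a nonnegative
  exponent by means of x^n = -1.\<close>

lemma X_power_inverse_cong:
  fixes n :: nat
  assumes "2 * n dvd Q + 1" "i \<le> n"
  shows "[X ^ (i * Q) = - (X ^ (n - i))] (mod nega_modulus n :: 'a::field poly)"
proof -
  let ?M = "nega_modulus n :: 'a poly"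
  have "[X ^ (i * Q) * 1 = X ^ (i * Q) * (- (X ^ n))] (mod ?M)"
    by (intro cong_scalar_left) (use X_power_n_cong[of n] in
        \<open>simp add: cong_iff_dvd_diff nega_modulus_def add.commute\<close>)
  also have "X ^ (i * Q) * (- (X ^ n)) = X ^ (i * (Q + 1)) * (- (X ^ (n - i)) :: 'a poly)"
    using assms(2) by (simp add: algebra_simps flip: power_add)
  also have "[\<dots> = 1 * (- (X ^ (n - i)))] (mod ?M)"
    by (intro cong_scalar_right X_power_cong dvd_mult assms(1))
  finally show ?thesis by simp
qed

text \<open>The Frobenius power fixes coefficients and inverts x, so it realises transposition. This
  turns the unitary condition into an equation on powers of a single polynomial.\<close>

lemma vec_poly_nega_conj_cong:
  fixes h :: "nat \<Rightarrow> 'a::{finite,field}"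
  assumes "2 * n dvd CARD('a) ^ e + 1"
  shows "[vec_poly n h ^ (CARD('a) ^ e) = vec_poly n (nega_conj n h)] (mod nega_modulus n)"
proof -
  let ?Q = "CARD('a) ^ e"
  have "vec_poly n h ^ ?Q = (\<Sum>i<n. monom (h i) (i * ?Q))"
    unfolding vec_poly_def by (rule poly_frobenius)
  \<comment> \<open>The index 0 is separate because there \<open>- (X ^ (n - i))\<close> is -x^n,
    which must still be reduced to 1.\<close>
  also have "[\<dots> = (\<Sum>i<n. if i = 0 then monom (h 0) 0 else monom (- h i) (n - i))] (mod nega_modulus n)"
  proof (rule cong_sum)
    fix i assume "i \<in> {..<n}"
    then have "[[:h i:] * X ^ (i * ?Q) = [:h i:] * - (X ^ (n - i))] (mod nega_modulus n)"
      by (intro cong_scalar_left X_power_inverse_cong assms) simp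
    moreover have "[:h i:] * - (X ^ (n - i)) = monom (- h i) (n - i)"
      unfolding monom_eq_X_power[of "- h i"] by simp
    ultimately show "[monom (h i) (i * ?Q) =
        (if i = 0 then monom (h 0) 0 else monom (- h i) (n - i))] (mod nega_modulus n)"
      unfolding monom_eq_X_power[of "h i" "i * ?Q"] by (cases "i = 0") (simp_all add: monom_0)
  qed
  also have "(\<Sum>i<n. if i = 0 then monom (h 0) 0 else monom (- h i) (n - i)) =
      (\<Sum>i<n. monom (nega_conj n h i) i)"
    by (rule sum.reindex_bij_witness[of _ "\<lambda>i. if i = 0 then 0 else n - i" "\<lambda>i. if i = 0 then 0 else n - i"])
       (auto simp: nega_conj_def negacirc_def)
  finally show ?thesis by (simp add: vec_poly_def)
qed

text \<open>Q^2 - 1 = (Q + 1)(Q - 1) is a multiple of 2n, so x^(i Q^2) = x^i. In the proof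
  \<open>r\<close> stands for Q - 1.\<close>

lemma frobenius_twice_cong:
  fixes f :: "'a::{finite,field} poly"
  assumes "2 * n dvd CARD('a) ^ e + 1"
  shows "[(f ^ (CARD('a) ^ e)) ^ (CARD('a) ^ e) = f] (mod nega_modulus n)"
proof -
  let ?Q = "CARD('a) ^ e"
  have f: "f = (\<Sum>i\<le>degree f. monom (coeff f i) i)" by (simp add: poly_as_sum_of_monoms)
  have "(f ^ ?Q) ^ ?Q = f ^ (CARD('a) ^ (e + e))" by (simp add: power_add power_mult)
  also have "\<dots> = (\<Sum>i\<le>degree f. monom (coeff f i) (i * CARD('a) ^ (e + e)))"
    by (subst f, rule poly_frobenius)
  also have "[\<dots> = (\<Sum>i\<le>degree f. monom (coeff f i) i)] (mod nega_modulus n)"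
  proof (rule cong_sum)
    fix i
    obtain r where r: "?Q = Suc r" by (metis not0_implies_Suc power_not_zero zero_less_card_finite less_not_refl)
    have "2 * n dvd i * ((?Q + 1) * r)" by (intro dvd_mult dvd_mult2 assms)
    then have "[X ^ (i * ((?Q + 1) * r)) * X ^ i = 1 * X ^ i] (mod nega_modulus n :: 'a poly)"
      by (intro cong_scalar_right X_power_cong)
    moreover have "i * CARD('a) ^ (e + e) = i * ((?Q + 1) * r) + i"
      by (simp add: power_add r algebra_simps)
    ultimately have "[X ^ (i * CARD('a) ^ (e + e)) = X ^ i] (mod nega_modulus n :: 'a poly)"
      by (simp only: power_add mult_1_left)
    then show "[monom (coeff f i) (i * CARD('a) ^ (e + e)) = monom (coeff f i) i] (mod nega_modulus n)"
      unfolding monom_eq_X_power[of "coeff f i"] by (intro cong_scalar_left) simp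
  qed
  finally show ?thesis using f by simp
qed

text \<open>
  The last factor is the inverse of \<open>1 + s\<close> modulo \<open>x\<^sup>n + 1\<close>: since \<open>(1 + s)\<^sup>Q \<equiv> 1 - s\<close>, we have
  \<open>(1 + s) ((1 + s)\<^bsup>Q-1\<^esup> + 1) \<equiv> (1 - s) + (1 + s) = 2\<close>.
\<close>
definition cayley_poly :: "nat \<Rightarrow> nat \<Rightarrow> 'a poly \<Rightarrow> 'a::field poly \<Rightarrow> 'a poly" where
  "cayley_poly n Q h0 c =
     (let s = c - c ^ Q in h0 * (1 - s) * ([:1 / 2:] * ((1 + s) ^ (Q - 1) + 1)))"

text \<open>Two Frobenius powers compose to the identity, so \<open>s\<close> is skew and
  conjugation exchanges \<open>1 + s\<close> and \<open>1 - s\<close>. The factor \<open>w\<close>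
  inverts \<open>1 + s\<close>, hence its conjugate inverts \<open>1 - s\<close>.\<close>

lemma cayley_cong:
  fixes c :: "'a::{finite,field} poly"
  assumes dvd: "2 * n dvd CARD('a) ^ e + 1" and two: "(2::'a) \<noteq> 0"
  defines "Q \<equiv> CARD('a) ^ e"
  defines "s \<equiv> c - c ^ Q"
  defines "w \<equiv> [:1 / 2:] * ((1 + s) ^ (Q - 1) + 1)"
  shows "[s ^ Q = - s] (mod nega_modulus n)"
    and "[(1 + s) * w = 1] (mod nega_modulus n)"
    and "[w ^ Q * (1 - s) = 1] (mod nega_modulus n)"
    and "[(1 - s) ^ Q = 1 + s] (mod nega_modulus n)"
proof -
  have Q0: "Q > 0" by (simp add: Q_def zero_less_card_finite)
  show sQ: "[s ^ Q = - s] (mod nega_modulus n)"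
  proof -
    have "s ^ Q = c ^ Q - (c ^ Q) ^ Q" unfolding s_def Q_def by (rule poly_frobenius_diff)
    also have "[\<dots> = c ^ Q - c] (mod nega_modulus n)"
      unfolding Q_def by (intro cong_diff frobenius_twice_cong dvd) simp
    finally show ?thesis by (simp add: s_def)
  qed
  have plus: "[(1 + s) ^ Q = 1 - s] (mod nega_modulus n)"
  proof -
    have "(1 + s) ^ Q = 1 + s ^ Q" unfolding Q_def poly_frobenius_add by simp
    also have "[\<dots> = 1 + - s] (mod nega_modulus n)" by (intro cong_add sQ) simp
    finally show ?thesis by simp
  qed
  show "[(1 - s) ^ Q = 1 + s] (mod nega_modulus n)"
  proof -
    have "(1 - s) ^ Q = 1 - s ^ Q" unfolding Q_def poly_frobenius_diff by simp
    also have "[\<dots> = 1 - - s] (mod nega_modulus n)" by (intro cong_diff sQ) simp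
    finally show ?thesis by simp
  qed
  have half: "[:1 / 2:] * (1 + 1) = (1 :: 'a poly)" using two by (simp add: one_pCons)
  show w: "[(1 + s) * w = 1] (mod nega_modulus n)"
  proof -
    have "(1 + s) * (1 + s) ^ (Q - 1) = (1 + s) ^ Q" using Q0 by (simp flip: power_Suc)
    then have "(1 + s) * w = [:1 / 2:] * ((1 + s) ^ Q + (1 + s))"
      by (simp only: w_def mult.left_commute[of "1 + s"] distrib_left[of "1 + s"] mult_1_right)
    also have "[\<dots> = [:1 / 2:] * ((1 - s) + (1 + s))] (mod nega_modulus n)"
      by (intro cong_scalar_left cong_add plus) simp_all
    also have "[:1 / 2:] * ((1 - s) + (1 + s)) = 1" using half by simp
    finally show ?thesis .
  qed
  show "[w ^ Q * (1 - s) = 1] (mod nega_modulus n)"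
  proof -
    have "[w ^ Q * (1 - s) = w ^ Q * (1 + s) ^ Q] (mod nega_modulus n)"
      by (intro cong_scalar_left cong_sym[OF plus])
    also have "w ^ Q * (1 + s) ^ Q = ((1 + s) * w) ^ Q" by (simp add: power_mult_distrib mult.commute)
    also have "[\<dots> = 1 ^ Q] (mod nega_modulus n)" by (intro cong_pow w)
    finally show ?thesis by simp
  qed
qed

text \<open>The factor (1 - s)/(1 + s) has conjugate (1 + s)/(1 - s), so twisting by it preserves
  the norm -1 of \<open>h0\<close>.\<close>

lemma cayley_poly_unitary:
  fixes c h0 :: "'a::{finite,field} poly"
  assumes dvd: "2 * n dvd CARD('a) ^ e + 1" and two: "(2::'a) \<noteq> 0"
    and h0: "[h0 ^ (CARD('a) ^ e) * h0 = - 1] (mod nega_modulus n)"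
  defines "h \<equiv> cayley_poly n (CARD('a) ^ e) h0 c"
  shows "[h ^ (CARD('a) ^ e) * h = - 1] (mod nega_modulus n)"
proof -
  define Q where "Q = CARD('a) ^ e"
  define s where "s = c - c ^ Q"
  define w where "w = [:1 / 2:] * ((1 + s) ^ (Q - 1) + 1)"
  note cay = cayley_cong[OF dvd two, of c, folded Q_def, folded s_def, folded w_def]
  have "h ^ Q * h = (h0 ^ Q * h0) * ((1 - s) ^ Q * w) * (w ^ Q * (1 - s))"
    unfolding h_def cayley_poly_def Q_def[symmetric] Let_def s_def[symmetric] w_def[symmetric]
    by (simp only: power_mult_distrib mult_ac)
  also have "[\<dots> = - 1 * 1 * 1] (mod nega_modulus n)"
  proof (intro cong_mult cay(3) h0[folded Q_def])
    have "[(1 - s) ^ Q * w = (1 + s) * w] (mod nega_modulus n)" by (intro cong_scalar_right cay(4))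
    also have "[(1 + s) * w = 1] (mod nega_modulus n)" by (rule cay(2))
    finally show "[(1 - s) ^ Q * w = 1] (mod nega_modulus n)" .
  qed
  finally show ?thesis by (simp add: Q_def)
qed

text \<open>Cancelling \<open>h0\<close> and clearing denominators leaves \<open>u\<close> times (1
  - s)(1 + s') - (1 - s')(1 + s) = 2(s' - s), and 2 is invertible.\<close>

lemma cayley_poly_inj:
  fixes c c' h0 u :: "'a::{finite,field} poly"
  assumes dvd: "2 * n dvd CARD('a) ^ e + 1" and two: "(2::'a) \<noteq> 0"
    and h0: "[h0 ^ (CARD('a) ^ e) * h0 = - 1] (mod nega_modulus n)"
    and eq: "[u * cayley_poly n (CARD('a) ^ e) h0 c =
              u * cayley_poly n (CARD('a) ^ e) h0 c'] (mod nega_modulus n)"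
  shows "[u * ((c - c') - (c - c') ^ (CARD('a) ^ e)) = 0] (mod nega_modulus n)"
proof -
  define Q where "Q = CARD('a) ^ e"
  define s where "s = c - c ^ Q"
  define w where "w = [:1 / 2:] * ((1 + s) ^ (Q - 1) + 1)"
  define s' where "s' = c' - c' ^ Q"
  define w' where "w' = [:1 / 2:] * ((1 + s') ^ (Q - 1) + 1)"
  note cay = cayley_cong[OF dvd two, of c, folded Q_def, folded s_def, folded w_def]
  note cay' = cayley_cong[OF dvd two, of c', folded Q_def, folded s'_def, folded w'_def]
  \<comment> \<open>\<open>h0 ^ Q\<close> inverts \<open>h0\<close> up to sign; the other two
    factors cancel \<open>w\<close> and \<open>w'\<close>.\<close>
  let ?k = "h0 ^ Q * ((1 + s) * (1 + s'))"
  have mid: "[u * (h0 * (1 - s) * w) * ?k = u * (h0 * (1 - s') * w') * ?k] (mod nega_modulus n)"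
    using eq unfolding cayley_poly_def Q_def[symmetric] Let_def s_def[symmetric] w_def[symmetric]
      s'_def[symmetric] w'_def[symmetric] by (rule cong_scalar_right)
  have l: "[u * (h0 * (1 - s) * w) * ?k = u * (1 - s) * (1 + s') * (- 1 * 1)] (mod nega_modulus n)"
  proof -
    have "u * (h0 * (1 - s) * w) * ?k = u * (1 - s) * (1 + s') * ((h0 ^ Q * h0) * ((1 + s) * w))"
      by (simp only: mult_ac)
    also have "[\<dots> = u * (1 - s) * (1 + s') * (- 1 * 1)] (mod nega_modulus n)"
      by (intro cong_scalar_left cong_mult cay h0[folded Q_def])
    finally show ?thesis .
  qed
  have r: "[u * (h0 * (1 - s') * w') * ?k = u * (1 - s') * (1 + s) * (- 1 * 1)] (mod nega_modulus n)"
  proof -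
    have "u * (h0 * (1 - s') * w') * ?k = u * (1 - s') * (1 + s) * ((h0 ^ Q * h0) * ((1 + s') * w'))"
      by (simp only: mult_ac)
    also have "[\<dots> = u * (1 - s') * (1 + s) * (- 1 * 1)] (mod nega_modulus n)"
      by (intro cong_scalar_left cong_mult cay' h0[folded Q_def])
    finally show ?thesis .
  qed
  have "[u * (1 - s) * (1 + s') * (- 1 * 1) = u * (1 - s') * (1 + s) * (- 1 * 1)] (mod nega_modulus n)"
    using cong_trans[OF cong_trans[OF cong_sym[OF l] mid] r] .
  then have "nega_modulus n dvd u * (1 - s) * (1 + s') * (- 1 * 1) - u * (1 - s') * (1 + s) * (- 1 * 1)"
    by (simp only: cong_iff_dvd_diff)
  also have "u * (1 - s) * (1 + s') * (- 1 * 1) - u * (1 - s') * (1 + s) * (- 1 * 1) = (1 + 1) * (u * (s - s'))"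
    by (simp add: algebra_simps)
  finally have "nega_modulus n dvd [:1 / 2:] * ((1 + 1) * (u * (s - s')))" by (rule dvd_mult)
  also have "[:1 / 2:] * ((1 + 1) * (u * (s - s'))) = u * (s - s')"
  proof -
    have "[:1 / 2:] * (1 + 1) = (1 :: 'a poly)" using two by (simp add: one_pCons)
    then show ?thesis by (simp only: mult.assoc[symmetric] mult_1_left)
  qed
  also have "s - s' = (c - c') - (c - c') ^ Q"
    unfolding s_def s'_def Q_def poly_frobenius_diff by simp
  finally show ?thesis by (simp only: cong_0_iff Q_def)
qed

text \<open>
  Multiplying \<open>f(x) - f(1/x)\<close> by \<open>x\<^sup>m\<close> clears the negative exponents.
\<close>
lemma skew_cong_low_degree:
  fixes f u :: "'a::{finite,field} poly"
  assumes dvd: "2 * n dvd CARD('a) ^ e + 1" and m: "m \<le> n"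
    and f: "\<And>i. i > m \<Longrightarrow> coeff f i = 0"
    and zero: "[u * (f - f ^ (CARD('a) ^ e)) = 0] (mod nega_modulus n)"
  defines "g \<equiv> X ^ m * f - (\<Sum>i\<le>m. monom (coeff f i) (m - i))"
  shows "[u * g = 0] (mod nega_modulus n)"
proof -
  let ?Q = "CARD('a) ^ e"
  have fsum: "f = (\<Sum>i\<le>m. monom (coeff f i) i)"
    using f by (auto simp: poly_eq_iff coeff_sum sum.delta not_le)
  have "X ^ m * f ^ ?Q = (\<Sum>i\<le>m. X ^ m * monom (coeff f i) (i * ?Q))"
    by (subst fsum, subst poly_frobenius) (rule sum_distrib_left)
  also have "[\<dots> = (\<Sum>i\<le>m. monom (coeff f i) (m - i))] (mod nega_modulus n)"
  proof (rule cong_sum)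
    fix i assume i: "i \<in> {..m}"
    have "X ^ m * monom (coeff f i) (i * ?Q) = [:coeff f i:] * X ^ (m - i) * X ^ (i * (?Q + 1))"
      using i unfolding monom_eq_X_power[of "coeff f i"]
      by (simp add: algebra_simps flip: power_add)
    also have "[\<dots> = [:coeff f i:] * X ^ (m - i) * 1] (mod nega_modulus n)"
      by (intro cong_scalar_left X_power_cong dvd_mult dvd)
    also have "[:coeff f i:] * X ^ (m - i) * 1 = monom (coeff f i) (m - i)"
      unfolding monom_eq_X_power[of "coeff f i"] by simp
    finally show "[X ^ m * monom (coeff f i) (i * ?Q) = monom (coeff f i) (m - i)] (mod nega_modulus n)" .
  qed
  finally have "[u * g = u * (X ^ m * f - X ^ m * f ^ ?Q)] (mod nega_modulus n)"
    unfolding g_def by (intro cong_scalar_left cong_diff cong_sym[of "X ^ m * f ^ ?Q"]) simp_all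
  also have "u * (X ^ m * f - X ^ m * f ^ ?Q) = X ^ m * (u * (f - f ^ ?Q))" by (simp add: algebra_simps)
  also have "[\<dots> = X ^ m * 0] (mod nega_modulus n)" by (intro cong_scalar_left zero)
  finally show ?thesis by simp
qed

text \<open>\<open>g\<close> carries \<open>f\<close> above exponent \<open>m\<close> and its
  negated mirror image below, so \<open>f\<close> can be read off from \<open>g\<close>. A nonzero
  constant term would cancel at exponent \<open>m\<close>, whence the assumption on
  \<open>coeff f 0\<close>.\<close>

lemma skew_low_degree:
  fixes f :: "'a::field poly"
  assumes f: "\<And>i. i > m \<Longrightarrow> coeff f i = 0" and f0: "coeff f 0 = 0"
  defines "g \<equiv> X ^ m * f - (\<Sum>i\<le>m. monom (coeff f i) (m - i))"
  shows "degree g \<le> 2 * m" and "g = 0 \<Longrightarrow> f = 0"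
proof -
  have coeff_g: "coeff g j = (if j < m then - coeff f (m - j) else coeff f (j - m))" for j
  proof -
    \<comment> \<open>The conjunct \<open>j \<le> m\<close> guards against truncated subtraction,
      which would make \<open>m - j\<close> equal to 0 for larger \<open>j\<close>.\<close>
    have "(\<Sum>i\<le>m. coeff (monom (coeff f i) (m - i)) j) = (\<Sum>i\<le>m. if i = m - j \<and> j \<le> m then coeff f i else 0)"
      by (intro sum.cong) auto
    also have "\<dots> = (if j \<le> m then coeff f (m - j) else 0)" by (simp add: sum.delta)
    finally show ?thesis
      using f0 by (auto simp: g_def coeff_sum monom_power coeff_monom_mult)
  qed
  show "degree g \<le> 2 * m"
    by (rule degree_le) (auto simp: coeff_g f)
  show "f = 0" if "g = 0"
  proof (rule poly_eqI)
    fix i show "coeff f i = coeff 0 i"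
      using coeff_g[of "m + i"] that by simp
  qed
qed

text \<open>For odd \<open>p\<close> this is (x^(2p) + 1)/(x^2 + 1), the cyclotomic polynomial of
  index 4p when \<open>p\<close> is also prime.\<close>

definition alt_sum_poly :: "nat \<Rightarrow> 'a::comm_ring_1 poly" where
  "alt_sum_poly p = (\<Sum>k<p. (- 1) ^ k * X ^ (2 * k))"

lemma alt_sum_poly_mult:
  "(X ^ 2 + 1) * alt_sum_poly p = 1 - (- 1) ^ p * (X ^ (2 * p) :: 'a::comm_ring_1 poly)"
  by (induction p) (simp_all add: alt_sum_poly_def algebra_simps power2_eq_square)

text \<open>
  Modulo an irreducible factor \<open>f\<close> of \<open>(x\<^bsup>2p\<^esup> + 1) / (x\<^sup>2 + 1)\<close> the element \<open>x\<close> has order exactly \<open>4p\<close>,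
  which therefore divides \<open>q\<^bsup>deg f\<^esup> - 1\<close>.
\<close>
lemma irreducible_factor_degree:
  fixes f :: "'a::{finite,field} poly"
  assumes p: "prime p" "odd p" "coprime p CARD('a)" and q: "odd CARD('a)"
    and f: "irreducible f" "f dvd alt_sum_poly p"
  shows "ord (4 * p) CARD('a) \<le> degree f"
proof -
  define N where "N = CARD('a) ^ degree f - 1"
  have f0: "f \<noteq> 0" and prime: "prime_elem f" and nu: "\<not> is_unit f"
    using f(1) field_poly_irreducible_imp_prime by (auto simp: irreducible_def)
  have deg: "degree f > 0" using f0 nu by (simp add: is_unit_iff_degree)
  have nconst: "\<not> f dvd [:c:]" if "c \<noteq> 0" for c
    using that deg by (auto dest: dvd_imp_degree_le)
  have CHAR: "of_nat k \<noteq> (0::'a)" if "coprime k CARD('a)" "k > 1" for k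
  proof
    assume "of_nat k = (0::'a)"
    then have "CHAR('a) dvd k" by (simp add: of_nat_eq_0_iff_char_dvd)
    moreover have "CHAR('a) dvd CARD('a)"
      using CHAR_dvd_CARD .
    ultimately have "is_unit CHAR('a)" using that(1) coprime_common_divisor by blast
    then show False by simp
  qed
  have "of_nat 2 \<noteq> (0::'a)" using q by (intro CHAR) simp_all
  then have two: "\<not> f dvd 1 + 1" using nconst[of 2] by (simp add: one_pCons)
  have pf: "of_nat p \<noteq> (0::'a)" using p(3) prime_gt_1_nat[OF p(1)] by (rule CHAR)
  have cn: "[X ^ (2 * p) = - 1] (mod f)"
  proof -
    have "f dvd (X ^ 2 + 1) * alt_sum_poly p" using f(2) by (rule dvd_mult)
    then show ?thesis
      using p(2) unfolding alt_sum_poly_mult by (simp add: cong_iff_dvd_diff add.commute)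
  qed
  have no1: "\<not> [X ^ j = 1] (mod f)" if "j dvd 2 * p" for j
  proof
    assume "[X ^ j = 1] (mod f)"
    moreover obtain k where "2 * p = j * k" using \<open>j dvd 2 * p\<close> ..
    ultimately have "[X ^ (2 * p) = 1 ^ k] (mod f)" by (simp only: power_mult cong_pow)
    from cong_trans[OF cong_sym[OF this] cn] have "f dvd 1 + 1" by (simp add: cong_iff_dvd_diff)
    then show False using two by simp
  qed
  \<comment> \<open>If x^4 = 1 then x^2 = -1, because x^2 = 1 is excluded. Every term of the
    alternating sum then becomes 1, so \<open>f\<close> would divide the nonzero constant
    \<open>p\<close>.\<close>
  have no4: "\<not> [X ^ 4 = 1] (mod f)"
  proof
    assume "[X ^ 4 = 1] (mod f)"
    then have "f dvd (X ^ 2 - 1) * (X ^ 2 + 1)"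
      by (simp add: cong_iff_dvd_diff algebra_simps flip: power_add)
    moreover have "\<not> f dvd X ^ 2 - 1" using no1[of 2] by (simp add: cong_iff_dvd_diff)
    ultimately have "f dvd X ^ 2 + 1" using prime by (simp add: prime_elem_dvd_mult_iff)
    then have x2: "[X ^ 2 = - 1] (mod f)" by (simp add: cong_iff_dvd_diff)
    have "[alt_sum_poly p = (\<Sum>k<p. (- 1) ^ k * (- 1) ^ k)] (mod f)"
      unfolding alt_sum_poly_def power_mult by (intro cong_sum cong_scalar_left cong_pow x2)
    also have "(\<Sum>k<p. (- 1) ^ k * (- 1) ^ k) = (of_nat p :: 'a poly)"
      by (simp flip: power_mult_distrib)
    finally have "f dvd of_nat p" using f(2) cong_dvd_iff by blast
    then show False using nconst[OF pf] by (simp add: of_nat_poly)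
  qed
  have "\<not> f dvd X"
  proof
    assume "f dvd X"
    moreover have "X dvd (X ^ (2 * p) :: 'a poly)" using p(1) by (intro dvd_power) (simp add: prime_gt_0_nat)
    ultimately have "f dvd X ^ (2 * p)" by (rule dvd_trans)
    then have "f dvd - 1" using cong_dvd_iff[OF cn] by simp
    then show False using nu by simp
  qed
  then have N: "[X ^ N = 1] (mod f)"
    unfolding N_def cong_iff_dvd_diff by (intro irreducible_dvd_power_card f)
  have c4: "[X ^ (4 * p) = 1] (mod f)"
    using cong_pow[OF cn, of 2] by (simp flip: power_mult)
  \<comment> \<open>By Bezout x^g = 1. It remains to see that \<open>g\<close> cannot be a proper
    divisor of 4p: some prime \<open>r\<close>, either 2 or \<open>p\<close>, would divide 4p/g, so
    \<open>g\<close> would divide 2p or 4, contrary to \<open>no1\<close> and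
    \<open>no4\<close>.\<close>
  define g where "g = gcd (4 * p) N"
  have g: "[X ^ g = 1] (mod f)"
  proof -
    have "4 * p \<noteq> 0" using p(1) by (simp add: prime_gt_0_nat)
    then obtain a b where ab: "(4 * p) * a = N * b + g" using bezout_nat g_def by blast
    have "[(X ^ N) ^ b * X ^ g = 1 ^ b * X ^ g] (mod f)" by (intro cong_scalar_right cong_pow N)
    then have "[X ^ ((4 * p) * a) = X ^ g] (mod f)" by (simp add: ab power_add power_mult)
    moreover have "[X ^ ((4 * p) * a) = 1] (mod f)" using cong_pow[OF c4, of a] by (simp add: power_mult)
    ultimately show ?thesis using cong_trans cong_sym by blast
  qed
  have "4 * p dvd N"
  proof (rule ccontr)
    assume "\<not> 4 * p dvd N"
    then have "g \<noteq> 4 * p" by (metis g_def gcd_dvd2)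
    moreover obtain t where t: "4 * p = g * t" using gcd_dvd1 g_def by (metis dvdE)
    ultimately have "t \<noteq> 1" by auto
    then obtain r where r: "prime r" "r dvd t" using prime_factor_nat by blast
    then have "r dvd 4 * p" using t by simp
    then have "r dvd 2 ^ 2 \<or> r dvd p" using r(1) by (simp add: prime_dvd_mult_iff)
    then have "r = 2 \<or> r = p" using r(1) p(1)
      by (metis prime_dvd_power primes_dvd_imp_eq two_is_prime_nat)
    moreover obtain t' where t': "t = r * t'" using r(2) ..
    ultimately have "2 * p = g * t' \<or> 4 = g * t'" using t p(1) by (auto simp: prime_gt_0_nat)
    then show False
    proof
      assume "2 * p = g * t'"
      then show False using no1[of g] g by simp
    next
      assume "4 = g * t'"
      then have "[X ^ 4 = 1 ^ t'] (mod f)" by (simp only: power_mult cong_pow g)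
      then show False using no4 by simp
    qed
  qed
  then have "[N + 1 = 0 + 1] (mod (4 * p))" by (intro cong_add) (simp_all only: cong_0_iff cong_refl)
  moreover have "N + 1 = CARD('a) ^ degree f" by (simp add: N_def zero_less_card_finite Suc_leI)
  ultimately have "[CARD('a) ^ degree f = 1] (mod (4 * p))" by simp
  then have "ord (4 * p) CARD('a) dvd degree f" by (simp only: ord_divides)
  then show ?thesis using deg by (rule dvd_imp_le)
qed

text \<open>
  Being annihilated by \<open>x\<^sup>2 + 1\<close> forces \<open>u\<^bsub>i+2\<^esub> = -u\<^sub>i\<close>, so a whole parity class of coordinates is nonzero.
\<close>
lemma weight_of_alt_sum_multiple:
  fixes u :: "nat \<Rightarrow> 'a::field"
  assumes p: "odd p" and zero: "[vec_poly (2 * p) u * (X ^ 2 + 1) = 0] (mod nega_modulus (2 * p))"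
    and nz: "j < 2 * p" "u j \<noteq> 0"
  shows "p \<le> card {i. i < 2 * p \<and> u i \<noteq> 0}"
proof -
  let ?n = "2 * p" and ?U = "vec_poly (2 * p) u"
  have n: "?n > 0" using nz by simp
  obtain k where k: "?U * (X ^ 2 + 1) = nega_modulus ?n * k"
    using zero by (auto simp: cong_0_iff)
  have U0: "?U \<noteq> 0" using nz coeff_vec_poly[of ?n u j] by auto
  have X2: "degree (X ^ 2 + 1 :: 'a poly) = 2" "X ^ 2 + 1 \<noteq> (0 :: 'a poly)"
    using degree_nega_modulus[of 2] by (simp_all add: nega_modulus_def monom_power)
  then have "?U * (X ^ 2 + 1) \<noteq> 0" using U0 by simp
  then have k0: "k \<noteq> 0" using k by auto
  have "degree ?U + 2 = ?n + degree k"
    using arg_cong[OF k, of degree] U0 X2 k0 degree_nega_modulus[OF n, where ?'a = 'a]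
    by (simp add: degree_mult_eq)
  then have degk: "degree k < 2" using degree_vec_poly[OF n, of u] by simp
  \<comment> \<open>As \<open>k\<close> has degree at most 1, its product with x^n + 1 has no terms
    of exponent 2 to n - 1.\<close>
  have rec: "u (i + 2) = - u i" if i: "i + 2 < ?n" for i
  proof -
    have "coeff (?U * (X ^ 2 + 1)) (i + 2) = u i + u (i + 2)"
      using i by (simp add: distrib_left monom_power mult.commute[of _ "monom _ _"] coeff_monom_mult coeff_vec_poly)
    moreover have "coeff (nega_modulus ?n * k) (i + 2) = 0"
      using i degk by (simp add: nega_modulus_def distrib_right coeff_monom_mult coeff_eq_0)
    ultimately show ?thesis using k by (simp add: add_eq_0_iff2 add.commute)
  qed
  define r where "r = j mod 2"
  have iff: "u (r + 2 * i) \<noteq> 0 \<longleftrightarrow> u r \<noteq> 0" if "i < p" for i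
    using that
  proof (induction i)
    case (Suc i)
    have "r + 2 * i + 2 < ?n" using Suc.prems by (simp add: r_def) 
    from rec[OF this] show ?case using Suc by simp
  qed simp
  have "j = r + 2 * (j div 2)" "j div 2 < p" using nz(1) by (auto simp: r_def)
  then have ur: "u r \<noteq> 0" using iff nz(2) by metis
  have "(\<lambda>i. r + 2 * i) ` {..<p} \<subseteq> {i. i < ?n \<and> u i \<noteq> 0}"
    using iff ur by (auto simp: r_def)
  then have "card ((\<lambda>i. r + 2 * i) ` {..<p}) \<le> card {i. i < ?n \<and> u i \<noteq> 0}"
    by (intro card_mono) auto
  then show ?thesis by (simp add: card_image inj_on_def)
qed

subsection \<open>Entropy\<close>

text \<open>The middle branch of \<open>Hq\<close>, kept apart so that calculus applies without case
  distinctions.\<close>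

definition entropy :: "nat \<Rightarrow> real \<Rightarrow> real" where
  "entropy q t = t * log q (real q - 1) - t * log q t - (1 - t) * log q (1 - t)"

lemma powr_entropy:
  assumes q: "q \<ge> 2" and t: "0 < t" "t < 1"
  shows "real q powr (- entropy q t) = (t / (real q - 1)) powr t * (1 - t) powr (1 - t)"
proof -
  have q1: "real q > 1" "real q - 1 > 0" using q by auto
  have "- entropy q t = t * log q (t / (real q - 1)) + (1 - t) * log q (1 - t)"
    using q1 t by (simp add: entropy_def log_divide algebra_simps)
  then have "real q powr (- entropy q t) =
      (real q powr log q (t / (real q - 1))) powr t * (real q powr log q (1 - t)) powr (1 - t)"
    by (simp add: powr_add powr_powr mult.commute)
  then show ?thesis using q1 t by simp
qed

text \<open>
  Draw the coordinates independently, each vanishing with probability \<open>1 - t\<close> and uniform otherwise: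
  every word of the ball then has probability at least \<open>q\<^bsup>-N H(t)\<^esup>\<close>.
\<close>
lemma card_ball_le:
  fixes N :: nat and t :: real
  assumes t: "0 < t" "t \<le> (real CARD('a::{finite,field}) - 1) / real CARD('a)"
  shows "real (card {v \<in> {..<N} \<rightarrow>\<^sub>E (UNIV :: 'a set). real (card {j. j < N \<and> v j \<noteq> 0}) \<le> t * real N})
    \<le> real CARD('a) powr (real N * entropy CARD('a) t)"
    (is "real (card ?B) \<le> _")
proof -
  define q where "q = CARD('a)"
  have "card {0, 1 :: 'a} \<le> q" unfolding q_def by (intro card_mono) auto
  then have q2: "q \<ge> 2" by simp
  then have q1: "real q > 1" by simp
  have "(real q - 1) / real q < 1" using q1 by simp
  then have t1: "t < 1" using t(2) unfolding q_def by linarith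
  define b where "b = t / (real q - 1)"
  \<comment> \<open>The bound \<open>b \<le> 1 - t\<close> is the hypothesis
    \<open>t \<le> (q - 1) / q\<close> rearranged: no nonzero symbol is likelier than 0, so the
    probability of a word decreases with its weight.\<close>
  have b: "b > 0" "b \<le> 1 - t" using t q1 by (simp_all add: b_def q_def field_simps)
  define f where "f x = (if x = 0 then 1 - t else b)" for x :: 'a
  define F :: "(nat \<Rightarrow> 'a) set" where "F = {..<N} \<rightarrow>\<^sub>E UNIV"
  have fin: "finite F" by (simp add: F_def finite_PiE)
  have B: "?B \<subseteq> F" by (auto simp: F_def)
  have f_sum: "(\<Sum>x\<in>UNIV. f x) = 1"
  proof -
    have "(\<Sum>x\<in>UNIV. f x) = f 0 + (\<Sum>x\<in>UNIV - {0}. f x)" by (simp add: sum.remove[of _ 0])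
    also have "(\<Sum>x\<in>UNIV - {0}. f x) = (\<Sum>x\<in>UNIV - {0::'a}. b)" by (intro sum.cong) (auto simp: f_def)
    also have "\<dots> = (real q - 1) * b" using q2 by (simp add: q_def card_Diff_subset of_nat_diff)
    also have "\<dots> = t" using q1 by (simp add: b_def)
    finally show ?thesis by (simp add: f_def)
  qed
  have total: "(\<Sum>v\<in>F. \<Prod>j<N. f (v j)) = 1"
  proof -
    have "(\<Prod>j<N. \<Sum>x\<in>UNIV. f x) = (\<Sum>v\<in>F. \<Prod>j<N. f (v j))"
      unfolding F_def by (rule prod_sum_PiE) auto
    then show ?thesis by (simp add: f_sum)
  qed
  have lower: "real q powr (- (real N * entropy q t)) \<le> (\<Prod>j<N. f (v j))" if "v \<in> ?B" for v
  proof -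
    define S where "S = {j. j < N \<and> v j \<noteq> 0}"
    define w where "w = card S"
    have S: "S \<subseteq> {..<N}" by (auto simp: S_def)
    have w: "real w \<le> t * real N" "w \<le> N"
      using that card_mono[OF _ S] by (auto simp: S_def w_def)
    have "(\<Prod>j<N. f (v j)) = (\<Prod>j\<in>{..<N} - S. f (v j)) * (\<Prod>j\<in>S. f (v j))"
      using S by (intro prod.subset_diff) auto
    also have "(\<Prod>j\<in>{..<N} - S. f (v j)) = (\<Prod>j\<in>{..<N} - S. 1 - t)"
      by (intro prod.cong) (auto simp: S_def f_def)
    also have "\<dots> = (1 - t) ^ (N - w)" using S finite_subset[OF S] by (simp add: card_Diff_subset w_def)
    also have "(\<Prod>j\<in>S. f (v j)) = (\<Prod>j\<in>S. b)"
      by (intro prod.cong) (auto simp: S_def f_def)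
    also have "\<dots> = b ^ w" by (simp add: w_def)
    finally have "(\<Prod>j<N. f (v j)) = (1 - t) ^ (N - w) * b ^ w" .
    also have "\<dots> = (1 - t) powr (real N - real w) * b powr real w"
      using t1 b w by (simp add: powr_realpow[symmetric] of_nat_diff)
    also have "\<dots> = (1 - t) powr real N * (b / (1 - t)) powr real w"
      using t1 b by (simp add: powr_diff powr_divide)
    \<comment> \<open>The weight is replaced by its maximum \<open>t * N\<close>; the base is at
      most 1.\<close>
    also have "\<dots> \<ge> (1 - t) powr real N * (b / (1 - t)) powr (t * real N)"
      using w b t1 by (intro mult_left_mono powr_mono') auto
    also have "(1 - t) powr real N * (b / (1 - t)) powr (t * real N) = 
        (1 - t) powr (real N - t * real N) * b powr (t * real N)"
      using t1 b by (simp add: powr_diff powr_divide)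
    also have "\<dots> = (b powr t * (1 - t) powr (1 - t)) powr real N"
      using t1 b by (simp add: powr_mult powr_powr algebra_simps)
    also have "b powr t * (1 - t) powr (1 - t) = real q powr (- entropy q t)"
      unfolding b_def using powr_entropy[OF q2 t(1) t1] by simp
    finally show ?thesis by (simp add: powr_powr mult.commute)
  qed
  have nonneg: "(\<Prod>j<N. f (v j)) \<ge> 0" for v
    using b t1 by (intro prod_nonneg) (auto simp: f_def)
  have "real (card ?B) * real q powr (- (real N * entropy q t)) = (\<Sum>v\<in>?B. real q powr (- (real N * entropy q t)))"
    by simp
  also have "\<dots> \<le> (\<Sum>v\<in>?B. \<Prod>j<N. f (v j))" by (intro sum_mono lower)
  also have "\<dots> \<le> (\<Sum>v\<in>F. \<Prod>j<N. f (v j))" by (intro sum_mono2 fin B nonneg)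
  finally have "real (card ?B) * real q powr (- (real N * entropy q t)) \<le> 1" by (simp add: total)
  then show ?thesis using q1 by (simp add: powr_minus field_simps q_def)
qed

text \<open>The derivative is the base-q logarithm of (q - 1)(1 - x)/x, positive exactly for x below
  (q - 1)/q.\<close>

lemma entropy_strict_mono:
  assumes q: "q \<ge> 2" and st: "0 < s" "s < t" "t < (real q - 1) / real q"
  shows "entropy q s < entropy q t"
proof (rule DERIV_pos_imp_increasing[OF st(2)])
  fix x assume x: "s \<le> x" "x \<le> t"
  have q1: "real q > 1" using q by simp
  have x0: "x > 0" and xu: "x < (real q - 1) / real q" using x st by auto
  have "(real q - 1) / real q < 1" using q1 by simp
  then have x1: "x < 1" using xu by simp
  have "x < (real q - 1) * (1 - x)" using xu q1 by (simp add: field_simps)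
  then have "ln x < ln ((real q - 1) * (1 - x))" using q1 x0 x1 by (subst ln_less_cancel_iff) auto
  then have pos: "(ln (real q - 1) - ln x + ln (1 - x)) / ln q > 0"
    using q1 x1 by (simp add: ln_mult)
  have eq: "entropy q = (\<lambda>t. (t * ln (real q - 1) - t * ln t - (1 - t) * ln (1 - t)) / ln q)"
    by (simp add: entropy_def log_def diff_divide_distrib fun_eq_iff)
  have "((\<lambda>t. t * ln (real q - 1) - t * ln t - (1 - t) * ln (1 - t)) has_real_derivative
      (ln (real q - 1) - ln x + ln (1 - x))) (at x)"
  proof -
    have "((\<lambda>t. t * ln t) has_real_derivative ln x + 1) (at x)"
      using x0 by (auto intro!: derivative_eq_intros)
    from DERIV_diff[OF DERIV_cmult_right[OF DERIV_ident] this]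
    have "((\<lambda>t. t * ln (real q - 1) - t * ln t) has_real_derivative ln (real q - 1) - (ln x + 1)) (at x)"
      by simp
    moreover have "((\<lambda>t. (1 - t) * ln (1 - t)) has_real_derivative - ln (1 - x) - 1) (at x)"
      using x1 by (auto intro!: derivative_eq_intros)
    ultimately show ?thesis by (rule DERIV_diff[THEN DERIV_cong]) simp
  qed
  then have "(entropy q has_real_derivative (ln (real q - 1) - ln x + ln (1 - x)) / ln q) (at x)"
    unfolding eq by (rule DERIV_cdivide)
  then show "\<exists>y. DERIV (entropy q) x :> y \<and> 0 < y" using pos by auto
qed

text \<open>Concavity on the chord from 0, made explicit: convexity of z ln z at 1 - t and 1 bounds
  the terms in 1 - t, and the terms in t contribute a surplus (t/2) ln 2.\<close>

lemma entropy_half_ge: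
  assumes q: "q \<ge> 2" and t: "0 < t" "t < 1"
  shows "entropy q (t / 2) \<ge> entropy q t / 2"
proof -
  have q0: "ln (real q) > 0" using q by simp
  have *: "a * ln (a / m) \<ge> a - m" if "a > 0" "m > 0" for a m :: real
  proof -
    have "ln (m / a) \<le> m / a - 1" using that by (intro ln_le_minus_one) auto
    then have "a * ln (m / a) \<le> a * (m / a - 1)" using that by (intro mult_left_mono) auto
    then show ?thesis using that by (simp add: ln_div algebra_simps)
  qed
  \<comment> \<open>\<open>?m\<close> is the mean of 1 - t and 1, so the linear terms of the two
    instances of \<open>*\<close> cancel.\<close>
  let ?m = "1 - t / 2"
  have "(1 - t) * ln ((1 - t) / ?m) + 1 * ln (1 / ?m) \<ge> ((1 - t) - ?m) + (1 - ?m)"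
    using t by (intro add_mono *) auto
  then have "(1 - t) * ln (1 - t) \<ge> 2 * ?m * ln ?m"
    using t by (simp add: ln_div algebra_simps)
  then have "?m * ln ?m \<le> (1 - t) / 2 * ln (1 - t)" by (simp add: algebra_simps)
  moreover have "0 \<le> t / 2 * ln 2" using t by simp
  ultimately have "?m * ln ?m - (1 - t) / 2 * ln (1 - t) \<le> t / 2 * ln 2" by simp
  then have "0 \<le> t / 2 * ln 2 + (1 - t) / 2 * ln (1 - t) - ?m * ln ?m" by simp
  also have "\<dots> = ln q * (entropy q (t / 2) - entropy q t / 2)"
    using q0 t by (simp add: entropy_def log_def ln_div field_simps)
  finally show ?thesis using q0 by (simp add: zero_le_mult_iff)
qed

text \<open>The terms in t give a quarter of log(4(q - 1)), which is at least a quarter of log q =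
  1; the last term is nonnegative.\<close>

lemma entropy_quarter_ge:
  assumes "q \<ge> 3"
  shows "entropy q (1 / 4) \<ge> 1 / 4"
proof -
  have q1: "real q > 1" using assms by simp
  have "log q (real q) \<le> log q (4 * (real q - 1))" using assms by (subst log_le_cancel_iff) auto
  also have "log q (4 * (real q - 1)) = log q 4 + log q (real q - 1)"
    using q1 by (simp only: log_def add_divide_distrib[symmetric]) (subst ln_mult, auto)
  finally have "log q q \<le> log q 4 + log q (real q - 1)" .
  then have "1 \<le> log q 4 + log q (real q - 1)" using q1 by simp
  moreover have "log q (3 / 4) \<le> 0" using q1 by simp
  moreover have "log q (1 / 4) = - log q 4" using q1 by (simp add: log_divide)
  ultimately show ?thesis by (simp add: entropy_def)
qed

text \<open>Intermediate value theorem between the limit 0 at the origin and the value at 1/4. The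
  bound 1/4 keeps the ball radius \<open>t * 4 * p\<close> at most \<open>p\<close>.\<close>

lemma entropy_eighth:
  assumes q: "q \<ge> 3"
  obtains t where "0 < t" "t \<le> 1 / 4" "entropy q t = 1 / 8"
proof -
  have q1: "real q > 1" using q by simp
  have "((\<lambda>t. entropy q t) \<longlongrightarrow> 0) (at_right 0)"
  proof -
    have "((\<lambda>t::real. t * ln t) \<longlongrightarrow> 0) (at_right 0)" by real_asymp
    then have "((\<lambda>t::real. t * log q (real q - 1) - t * ln t / ln q - (1 - t) * log q (1 - t)) 
        \<longlongrightarrow> 0 * log q (real q - 1) - 0 / ln q - (1 - 0) * log q (1 - 0)) (at_right 0)"
      using q1 by (intro tendsto_intros) auto
    then show ?thesis by (simp add: entropy_def log_def)
  qed
  then have "\<forall>\<^sub>F t in at_right 0. entropy q t < 1 / 8" by (rule order_tendstoD) simp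
  moreover have "\<forall>\<^sub>F t in at_right (0::real). t < 1 / 4 \<and> 0 < t"
    by (auto simp: eventually_at_right[of 0 1] intro: exI[of _ "1/4"])
  ultimately have "\<forall>\<^sub>F t in at_right 0. entropy q t < 1 / 8 \<and> t < 1 / 4 \<and> 0 < t"
    by (rule eventually_conj)
  then obtain s where s: "entropy q s < 1 / 8" "s < 1 / 4" "0 < s"
    by (metis (no_types, lifting) eventually_happens trivial_limit_at_right_real)
  have "\<exists>t. s \<le> t \<and> t \<le> 1 / 4 \<and> entropy q t = 1 / 8"
  proof (rule IVT')
    show "entropy q s \<le> 1 / 8" using s by simp
    show "1 / 8 \<le> entropy q (1 / 4)" using entropy_quarter_ge[OF q] by simp
    show "s \<le> 1 / 4" using s by simp
    show "continuous_on {s..1 / 4} (entropy q)"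
      unfolding entropy_def log_def using s q1 by (auto intro!: continuous_intros)
  qed
  then show thesis using that s by (metis less_le_trans)
qed

subsection \<open>Minimum distances\<close>

definition weight :: "nat \<Rightarrow> (nat \<Rightarrow> 'a::zero) \<Rightarrow> nat" where
  "weight N v = card {j. j < N \<and> v j \<noteq> 0}"

lemma hamming_dist_eq_weight:
  "hamming_dist N x y = weight N (\<lambda>j. x j - y j :: 'a::ab_group_add)"
  by (simp add: hamming_dist_def weight_def)

lemma finite_hamming_dists: "finite {hamming_dist N x y | x y. x \<in> C \<and> y \<in> C \<and> x \<noteq> y}"
proof (rule finite_subset)
  have "hamming_dist N x y \<le> card {..<N}" for x y :: "nat \<Rightarrow> 'a"
    unfolding hamming_dist_def by (intro card_mono) auto
  then show "{hamming_dist N x y | x y. x \<in> C \<and> y \<in> C \<and> x \<noteq> y} \<subseteq> {..N}" by auto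
qed simp

text \<open>The two distinct words make the set of distances nonempty, without which its
  \<open>Min\<close> is unspecified.\<close>

lemma min_dist_geI:
  assumes "x \<in> C" "y \<in> C" "x \<noteq> y"
    and "\<And>x y. x \<in> C \<Longrightarrow> y \<in> C \<Longrightarrow> x \<noteq> y \<Longrightarrow> d \<le> hamming_dist N x y"
  shows "d \<le> min_dist N C"
  unfolding min_dist_def using assms by (subst Min_ge_iff[OF finite_hamming_dists]) auto

lemma min_dist_le:
  assumes "x \<in> C" "y \<in> C" "x \<noteq> y"
  shows "min_dist N C \<le> hamming_dist N x y"
  unfolding min_dist_def using assms by (intro Min_le finite_hamming_dists) auto

lemma min_dist_le_length:
  assumes "x \<in> C" "y \<in> C" "x \<noteq> y"
  shows "min_dist N C \<le> N"
proof -
  have "hamming_dist N x y \<le> card {..<N}"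
    unfolding hamming_dist_def by (intro card_mono) auto
  then show ?thesis using min_dist_le[OF assms, of N] by simp
qed

lemma double_word_diff:
  "double_word n h u j - double_word n h v j = double_word n h (\<lambda>i. u i - v i) j"
  by (simp add: double_word_def vec_negacirc_diff)

lemma double_word_zero: "double_word n h (\<lambda>_. 0) = (\<lambda>_. 0)"
  by (simp add: double_word_def vec_negacirc_def fun_eq_iff)

lemma double_word_cong: "(\<And>i. i < n \<Longrightarrow> u i = v i) \<Longrightarrow> double_word n h u = double_word n h v"
  using vec_negacirc_cong[of n u v h] by (simp add: double_word_def fun_eq_iff)

lemma double_code_nontrivial:
  assumes "n > 0"
  shows "double_word n h (\<lambda>_. 1) \<in> double_negacirc_code n h"
    and "(\<lambda>_. 0) \<in> double_negacirc_code n h"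
    and "double_word n h (\<lambda>_. 1) \<noteq> (\<lambda>_. 0)"
proof -
  show "(\<lambda>_. 0) \<in> double_negacirc_code n h"
    unfolding double_negacirc_code_eq
    using rangeI[of "double_word n h" "\<lambda>_. 0"] by (simp only: double_word_zero)
  have "double_word n h (\<lambda>_. 1) 0 \<noteq> 0" using assms by (simp add: double_word_def)
  then show "double_word n h (\<lambda>_. 1) \<noteq> (\<lambda>_. 0)" by metis
qed (simp add: double_negacirc_code_eq)

lemma min_dist_double_ge:
  assumes "n > 0" and "\<And>u. \<exists>i<n. u i \<noteq> 0 \<Longrightarrow> d \<le> weight (2 * n) (double_word n h u)"
  shows "d \<le> min_dist (2 * n) (double_negacirc_code n h)"
proof (rule min_dist_geI[OF double_code_nontrivial[OF assms(1)]])
  fix x y assume "x \<in> double_negacirc_code n h" "y \<in> double_negacirc_code n h" and xy: "x \<noteq> y"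
  then obtain u v where x: "x = double_word n h u" and y: "y = double_word n h v"
    by (auto simp: double_negacirc_code_eq)
  have "\<exists>i<n. u i - v i \<noteq> 0" using xy double_word_cong[of n u v h] unfolding x y by auto
  then show "d \<le> hamming_dist (2 * n) x y"
    unfolding hamming_dist_eq_weight x y double_word_diff by (rule assms(2))
qed

lemma weight_double_ge_min_dist:
  assumes "i < n" "u i \<noteq> 0"
  shows "min_dist (2 * n) (double_negacirc_code n h) \<le> weight (2 * n) (double_word n h u)"
proof -
  have n: "n > 0" using assms by simp
  have "double_word n h u i \<noteq> 0" using assms by (simp add: double_word_def)
  then have "double_word n h u \<noteq> (\<lambda>_. 0)" by metis
  from min_dist_le[OF _ double_code_nontrivial(2)[OF n] this, of h "2 * n"]
  show ?thesis by (simp add: double_negacirc_code_eq hamming_dist_eq_weight)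
qed

lemma weight_split:
  fixes v :: "nat \<Rightarrow> 'a::zero"
  shows "weight (2 * n) v = weight n v + weight n (\<lambda>j. v (n + j))"
proof -
  have "{j. j < 2 * n \<and> v j \<noteq> 0} = {j. j < n \<and> v j \<noteq> 0} \<union> (\<lambda>j. n + j) ` {j. j < n \<and> v (n + j) \<noteq> 0}"
  proof (intro equalityI subsetI)
    fix j assume j: "j \<in> {j. j < 2 * n \<and> v j \<noteq> 0}"
    show "j \<in> {j. j < n \<and> v j \<noteq> 0} \<union> (\<lambda>j. n + j) ` {j. j < n \<and> v (n + j) \<noteq> 0}"
    proof (cases "j < n")
      case False
      then have "j = n + (j - n)" by simp
      then show ?thesis using j False by (intro UnI2 image_eqI[of _ _ "j - n"]) auto
    qed (use j in auto)
  qed auto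
  then have "weight (2 * n) v = card ({j. j < n \<and> v j \<noteq> 0} \<union> (\<lambda>j. n + j) ` {j. j < n \<and> v (n + j) \<noteq> 0})"
    by (simp add: weight_def)
  also have "\<dots> = card {j. j < n \<and> v j \<noteq> 0} + card ((\<lambda>j. n + j) ` {j. j < n \<and> v (n + j) \<noteq> 0})"
    by (rule card_Un_disjoint) auto
  finally show ?thesis by (simp add: weight_def card_image)
qed

lemma weight_cong: "(\<And>j. j < N \<Longrightarrow> u j = 0 \<longleftrightarrow> v j = 0) \<Longrightarrow> weight N u = weight N v"
  unfolding weight_def by (rule arg_cong[where f = card]) auto

lemma weight_double_word:
  "weight (2 * n) (double_word n h u) = weight n u + weight n (vec_negacirc n u h)"
proof -
  have "weight n (double_word n h u) = weight n u"
    by (rule weight_cong) (simp add: double_word_def)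
  moreover have "weight n (\<lambda>j. double_word n h u (n + j)) = weight n (vec_negacirc n u h)"
    by (rule weight_cong) (simp add: double_word_def)
  ultimately show ?thesis by (simp add: weight_split)
qed

text \<open>Used for the second summand of a four-negacirculant code with b = 0, which is the code
  of the conjugate.\<close>

lemma min_dist_double_conj:
  assumes h: "nega_unitary n h" and n: "n > 0"
  shows "min_dist (2 * n) (double_negacirc_code n h)
    \<le> min_dist (2 * n) (double_negacirc_code n (nega_conj n h))"
proof (rule min_dist_double_ge[OF n])
  fix v :: "nat \<Rightarrow> 'a" assume "\<exists>i<n. v i \<noteq> 0"
  then obtain i where i: "i < n" "v i \<noteq> 0" by auto
  define w where "w = vec_negacirc n v (nega_conj n h)"
  \<comment> \<open>The words \<open>(v, w)\<close> and \<open>(w, -v)\<close> of the two codes have the same weight.\<close>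
  have back_eq: "vec_negacirc n w h j = - v j" if "j < n" for j
    unfolding w_def by (rule nega_unitary_inverse(2)[OF h that])
  have "\<exists>j<n. w j \<noteq> 0"
  proof (rule ccontr)
    assume "\<not> (\<exists>j<n. w j \<noteq> 0)"
    then have "vec_negacirc n w h i = 0" by (simp add: vec_negacirc_def)
    then show False using back_eq i by simp
  qed
  then obtain j where "j < n" "w j \<noteq> 0" by auto
  then have "min_dist (2 * n) (double_negacirc_code n h) \<le> weight (2 * n) (double_word n h w)"
    by (rule weight_double_ge_min_dist)
  also have "\<dots> = weight n w + weight n v"
    unfolding weight_double_word by (simp add: weight_cong[of n "vec_negacirc n w h" v] back_eq)
  also have "\<dots> = weight (2 * n) (double_word n (nega_conj n h) v)"
    by (simp add: weight_double_word w_def)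
  finally show "min_dist (2 * n) (double_negacirc_code n h)
      \<le> weight (2 * n) (double_word n (nega_conj n h) v)" .
qed

section \<open>Four-negacirculant codes with b = 0\<close>

definition interleave :: "nat \<Rightarrow> (nat \<Rightarrow> 'a::zero) \<Rightarrow> (nat \<Rightarrow> 'a) \<Rightarrow> nat \<Rightarrow> 'a" where
  "interleave n x y j = (if j < n then x j else if j < 2 * n then y (j - n)
     else if j < 3 * n then x (j - n) else if j < 4 * n then y (j - 2 * n) else 0)"

text \<open>With B = 0 the generator matrix splits into (I A) on the first and third blocks of
  coordinates and (I A^t) on the second and fourth.\<close>

lemma four_negacirc_code_zero_eq:
  fixes a :: "nat \<Rightarrow> 'a::field"
  shows "four_negacirc_code n a (\<lambda>_. 0) =
    {interleave n x y | x y. x \<in> double_negacirc_code n a \<and> y \<in> double_negacirc_code n (nega_conj n a)}"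
proof -
  let ?word = "\<lambda>u j. if j < 4 * n then \<Sum>i<2 * n. u i * four_gen n a (\<lambda>_. 0) i j else 0"
  have word: "?word u = interleave n (double_word n a u) (double_word n (nega_conj n a) (\<lambda>i. u (n + i)))" for u
  proof
    fix j
    have B: "negacirc n (\<lambda>_. 0 :: 'a) i k = 0" for i k by (simp add: negacirc_def)
    have unit: "(\<Sum>i<n. f i * id_mat i k) = f k" if "k < n" for f :: "nat \<Rightarrow> 'a" and k
      using that by (simp add: id_mat_def sum.delta if_distrib cong: if_cong)
    have tr: "(\<Sum>i<n. u (n + i) * negacirc n a k i) = vec_negacirc n (\<lambda>i. u (n + i)) (nega_conj n a) k"
      if "k < n" for k
      unfolding vec_negacirc_def using that by (intro sum.cong refl) (simp add: negacirc_transpose[of _ n k a])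
    consider "j < n" | "n \<le> j" "j < 2 * n" | "2 * n \<le> j" "j < 3 * n" | "3 * n \<le> j" "j < 4 * n" | "4 * n \<le> j"
      by linarith
    then show "?word u j = interleave n (double_word n a u) (double_word n (nega_conj n a) (\<lambda>i. u (n + i))) j"
    proof cases
      case 1
      then show ?thesis
        by (simp add: sum_split_double four_gen_def interleave_def double_word_def unit)
    next
      case 2
      then have "j - n < n" by simp
      then show ?thesis using 2 unit[of "j - n" "\<lambda>i. u (n + i)"]
        by (simp add: sum_split_double four_gen_def interleave_def double_word_def)
    next
      case 3
      then have "j - n < 2 * n" "\<not> j - n < n" "j - n - n = j - 2 * n" by simp_all
      then show ?thesis using 3
        by (simp add: sum_split_double four_gen_def interleave_def double_word_def B transp_mat_def
            vec_negacirc_def Let_def)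
    next
      case 4
      then have "j - 2 * n < 2 * n" "\<not> j - 2 * n < n" "j - 2 * n - n = j - 3 * n" by simp_all
      then show ?thesis using 4 tr[of "j - 3 * n"]
        by (simp add: sum_split_double four_gen_def interleave_def double_word_def B transp_mat_def Let_def)
    next
      case 5
      then show ?thesis by (simp add: interleave_def)
    qed
  qed
  show ?thesis
  proof (intro equalityI subsetI)
    fix c assume "c \<in> four_negacirc_code n a (\<lambda>_. 0)"
    then obtain u where "c = ?word u" by (auto simp: four_negacirc_code_def gen_code_def)
    then show "c \<in> {interleave n x y | x y. x \<in> double_negacirc_code n a \<and>
        y \<in> double_negacirc_code n (nega_conj n a)}"
      unfolding word double_negacirc_code_eq by blast
  next
    fix c assume "c \<in> {interleave n x y | x y. x \<in> double_negacirc_code n a \<and>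
        y \<in> double_negacirc_code n (nega_conj n a)}"
    then obtain u v where c: "c = interleave n (double_word n a u) (double_word n (nega_conj n a) v)"
      by (auto simp: double_negacirc_code_eq)
    define w where "w i = (if i < n then u i else v (i - n))" for i
    have 1: "double_word n a w = double_word n a u"
      by (rule double_word_cong) (simp add: w_def)
    have 2: "(\<lambda>i. w (n + i)) = v" by (simp add: w_def)
    have "c = ?word w" unfolding word c 1 2 ..
    then show "c \<in> four_negacirc_code n a (\<lambda>_. 0)"
      unfolding four_negacirc_code_def gen_code_def by blast
  qed
qed

lemma sum_interleave:
  fixes x y z :: "nat \<Rightarrow> 'a::comm_semiring_0"
  shows "(\<Sum>j<4 * n. interleave n x y j * z j) =
    (\<Sum>j<2 * n. x j * (if j < n then z j else z (n + j))) +
    (\<Sum>j<2 * n. y j * (if j < n then z (n + j) else z (2 * n + j)))"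
proof -
  have "(\<Sum>j<4 * n. interleave n x y j * z j) = (\<Sum>j<2 * (2 * n). interleave n x y j * z j)" by simp
  also have "\<dots> = (\<Sum>j<n. x j * z j) + (\<Sum>j<n. y j * z (n + j)) +
      ((\<Sum>j<n. x (n + j) * z (2 * n + j)) + (\<Sum>j<n. y (n + j) * z (2 * n + (n + j))))"
    unfolding sum_split_double[of _ "2 * n"] sum_split_double[of _ n]
    by (intro arg_cong2[where f = "(+)"] sum.cong refl) (simp_all add: interleave_def)
  finally have eq: "(\<Sum>j<4 * n. interleave n x y j * z j) = \<dots>" .
  have two: "2 * n + j = n + (n + j)" for j by simp
  have low: "(\<Sum>j<n. f j * (if j < n then g j else g' j)) = (\<Sum>j<n. f j * g j)" for f g g' :: "nat \<Rightarrow> 'a"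
    by simp
  show ?thesis
    unfolding eq sum_split_double[of _ n] two low by (simp add: ac_simps)
qed

text \<open>Interleaving is a coordinate permutation of the direct sum, so the inner product splits
  into two parts. Pairing with (x, 0) and (0, y) separates the two orthogonality conditions.\<close>

lemma self_dual_interleave:
  fixes C D :: "(nat \<Rightarrow> 'a::field) set"
  assumes C: "self_dual (2 * n) C" and D: "self_dual (2 * n) D"
  shows "self_dual (4 * n) {interleave n x y | x y. x \<in> C \<and> y \<in> D}"
proof -
  define pr1 where "pr1 z j = (if j < 2 * n then if j < n then z j else z (n + j) else 0)" for z :: "nat \<Rightarrow> 'a" and j
  define pr2 where "pr2 z j = (if j < 2 * n then if j < n then z (n + j) else z (2 * n + j) else 0)" for z :: "nat \<Rightarrow> 'a" and j
  have C_eq: "C = dual_code (2 * n) C" and D_eq: "D = dual_code (2 * n) D"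
    using C D by (simp_all add: self_dual_def)
  have sum: "(\<Sum>j<4 * n. interleave n x y j * z j) = (\<Sum>j<2 * n. x j * pr1 z j) + (\<Sum>j<2 * n. y j * pr2 z j)" for x y z
    unfolding sum_interleave by (simp add: pr1_def pr2_def)
  have supp: "x j = 0" if "x \<in> C \<union> D" "j \<ge> 2 * n" for x j
    using that C_eq D_eq by (auto simp: dual_code_def)
  have C0: "(\<lambda>_. 0) \<in> C" by (subst C_eq) (simp add: dual_code_def)
  have D0: "(\<lambda>_. 0) \<in> D" by (subst D_eq) (simp add: dual_code_def)
  have orthC: "(\<Sum>j<2 * n. x j * x' j) = 0" if "x \<in> C" "x' \<in> C" for x x'
    using that C_eq by (auto simp: dual_code_def)
  have orthD: "(\<Sum>j<2 * n. x j * x' j) = 0" if "x \<in> D" "x' \<in> D" for x x'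
    using that D_eq by (auto simp: dual_code_def)
  have pr1: "pr1 (interleave n x y) = x" if "x \<in> C" for x y
    using supp[of x] that by (auto simp: pr1_def interleave_def fun_eq_iff)
  have pr2: "pr2 (interleave n x y) = y" if "y \<in> D" for x y
    using supp[of y] that by (auto simp: pr2_def interleave_def fun_eq_iff)
  show ?thesis
    unfolding self_dual_def
  proof (intro equalityI subsetI)
    fix z assume "z \<in> {interleave n x y | x y. x \<in> C \<and> y \<in> D}"
    then obtain x y where "z = interleave n x y" "x \<in> C" "y \<in> D" by auto
    then show "z \<in> dual_code (4 * n) {interleave n x y | x y. x \<in> C \<and> y \<in> D}"
      by (auto simp: dual_code_def sum pr1 pr2 orthC orthD) (simp add: interleave_def)
  next
    fix z assume z: "z \<in> dual_code (4 * n) {interleave n x y | x y. x \<in> C \<and> y \<in> D}"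
    then have orth: "(\<Sum>j<2 * n. x j * pr1 z j) + (\<Sum>j<2 * n. y j * pr2 z j) = 0" if "x \<in> C" "y \<in> D" for x y
      using that by (auto simp: dual_code_def sum[symmetric])
    have "pr1 z \<in> C"
      using orth[OF _ D0] by (subst C_eq) (simp add: dual_code_def pr1_def)
    moreover have "pr2 z \<in> D"
      using orth[OF C0] by (subst D_eq) (simp add: dual_code_def pr2_def)
    moreover have "interleave n (pr1 z) (pr2 z) = z"
      using z by (auto simp: interleave_def pr1_def pr2_def dual_code_def fun_eq_iff)
    ultimately show "z \<in> {interleave n x y | x y. x \<in> C \<and> y \<in> D}"
      by (intro CollectI exI[of _ "pr1 z"] exI[of _ "pr2 z"]) simp
  qed
qed

lemma hamming_dist_interleave:
  "hamming_dist (2 * n) x x' \<le> hamming_dist (4 * n) (interleave n x y) (interleave n x' y')" (is ?th1)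
  "hamming_dist (2 * n) y y' \<le> hamming_dist (4 * n) (interleave n x y) (interleave n x' y')" (is ?th2)
proof -
  let ?S = "{j. j < 4 * n \<and> interleave n x y j \<noteq> interleave n x' y' j}"
  let ?f = "\<lambda>j. if j < n then j else n + j" and ?g = "\<lambda>j. if j < n then n + j else 2 * n + j"
  have "card (?f ` {j. j < 2 * n \<and> x j \<noteq> x' j}) \<le> card ?S"
    by (intro card_mono) (auto simp: interleave_def)
  then show ?th1 by (subst (asm) card_image) (auto simp: hamming_dist_def inj_on_def split: if_splits)
  have "card (?g ` {j. j < 2 * n \<and> y j \<noteq> y' j}) \<le> card ?S"
    by (intro card_mono) (auto simp: interleave_def)
  then show ?th2 by (subst (asm) card_image) (auto simp: hamming_dist_def inj_on_def split: if_splits)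
qed

lemma four_code_nontrivial:
  assumes "n > 0"
  obtains x y where "x \<in> four_negacirc_code n a (\<lambda>_. 0)" "y \<in> four_negacirc_code n a (\<lambda>_. 0)" "x \<noteq> y"
proof -
  note C = double_code_nontrivial[OF assms, of a]
  note D = double_code_nontrivial(2)[OF assms, of "nega_conj n a"]
  let ?x = "interleave n (double_word n a (\<lambda>_. 1)) (\<lambda>_. 0)" and ?y = "interleave n (\<lambda>_. 0) (\<lambda>_. 0)"
  have "?x 0 \<noteq> ?y 0" using assms by (simp add: interleave_def double_word_def)
  then have "?x \<noteq> ?y" by metis
  moreover have "?x \<in> four_negacirc_code n a (\<lambda>_. 0)" "?y \<in> four_negacirc_code n a (\<lambda>_. 0)"
    unfolding four_negacirc_code_zero_eq using C D by blast+
  ultimately show thesis using that by blast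
qed

text \<open>Distinct words differ in a component, and by \<open>min_dist_double_conj\<close> either
  component is at least as far apart as the minimum distance of the code of
  \<open>h\<close>.\<close>

lemma min_dist_four_ge:
  assumes h: "nega_unitary n h" and n: "n > 0"
  shows "min_dist (2 * n) (double_negacirc_code n h) \<le> min_dist (4 * n) (four_negacirc_code n h (\<lambda>_. 0))"
proof -
  obtain x y where "x \<in> four_negacirc_code n h (\<lambda>_. 0)" "y \<in> four_negacirc_code n h (\<lambda>_. 0)" "x \<noteq> y"
    by (rule four_code_nontrivial[OF n])
  then show ?thesis
  proof (rule min_dist_geI)
    fix c c' assume "c \<in> four_negacirc_code n h (\<lambda>_. 0)" "c' \<in> four_negacirc_code n h (\<lambda>_. 0)" and ne: "c \<noteq> c'"
    then obtain x y x' y' where c: "c = interleave n x y" "c' = interleave n x' y'"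
      and x: "x \<in> double_negacirc_code n h" "x' \<in> double_negacirc_code n h"
      and y: "y \<in> double_negacirc_code n (nega_conj n h)" "y' \<in> double_negacirc_code n (nega_conj n h)"
      unfolding four_negacirc_code_zero_eq by blast
    have "x \<noteq> x' \<or> y \<noteq> y'" using ne c by auto
    then show "min_dist (2 * n) (double_negacirc_code n h) \<le> hamming_dist (4 * n) c c'"
    proof
      assume "x \<noteq> x'"
      then show ?thesis unfolding c
        using min_dist_le[OF x] hamming_dist_interleave(1) order_trans by blast
    next
      assume "y \<noteq> y'"
      then show ?thesis unfolding c
        using min_dist_double_conj[OF h n] min_dist_le[OF y] hamming_dist_interleave(2) order_trans by metis
    qed
  qed
qed

lemma self_dual_four:
  assumes "nega_unitary n h"
  shows "self_dual (4 * n) (four_negacirc_code n h (\<lambda>_. 0))"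
  unfolding four_negacirc_code_zero_eq
  by (intro self_dual_interleave self_dual_double nega_unitary_conj assms)

subsection \<open>Existence of good codes\<close>

text \<open>With n = 2p, conjugation sends x^p to -x^p. Hence a + b x^p has norm a^2 - b^2 x^(2p) =
  a^2 + b^2, and a, b are chosen to make this -1.\<close>

lemma base_unitary_poly:
  assumes odd: "odd CARD('a::{finite,field})" and dvd: "2 * (2 * p) dvd CARD('a) ^ e + 1"
  obtains h0 :: "'a::{finite,field} poly" where "[h0 ^ (CARD('a) ^ e) * h0 = - 1] (mod nega_modulus (2 * p))"
proof -
  let ?Q = "CARD('a) ^ e" and ?M = "nega_modulus (2 * p) :: 'a poly"
  obtain a b :: 'a where ab: "a\<^sup>2 + b\<^sup>2 = - 1" using sum_two_squares[OF odd] by blast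
  have pow: "x ^ ?Q = x" for x :: 'a
    by (induction e) (simp_all add: power_mult power_card_eq_same)
  define h0 where "h0 = [:a:] + [:b:] * X ^ p"
  have "h0 ^ ?Q = [:a:] + [:b:] * X ^ (p * ?Q)"
    unfolding h0_def poly_frobenius_add by (simp only: power_mult_distrib poly_const_pow pow power_mult)
  also have "[\<dots> = [:a:] + [:b:] * - (X ^ (2 * p - p))] (mod ?M)"
    by (intro cong_add cong_scalar_left X_power_inverse_cong[OF dvd]) simp_all
  finally have left: "[h0 ^ ?Q * h0 = ([:a:] - [:b:] * X ^ p) * h0] (mod ?M)"
    by (intro cong_scalar_right) simp
  have "X ^ (2 * p) = X ^ p * (X ^ p :: 'a poly)" by (simp add: mult_2 power_add)
  then have prod: "([:a:] - [:b:] * X ^ p) * h0 = [:a:]\<^sup>2 - [:b:]\<^sup>2 * X ^ (2 * p)"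
    by (simp add: h0_def algebra_simps power2_eq_square)
  note left[unfolded prod]
  also have "[[:a:]\<^sup>2 - [:b:]\<^sup>2 * X ^ (2 * p) = [:a:]\<^sup>2 - [:b:]\<^sup>2 * - 1] (mod ?M)"
    by (intro cong_diff cong_scalar_left X_power_n_cong) simp
  also have "[:a:]\<^sup>2 - [:b:]\<^sup>2 * - 1 = [:a\<^sup>2 + b\<^sup>2:]" by (simp add: power2_eq_square)
  also have "\<dots> = - 1" by (simp add: ab one_pCons)
  finally show thesis by (rule that)
qed

lemma nega_unitary_coeff_mod:
  fixes h :: "'a::{finite,field} poly"
  assumes dvd: "2 * n dvd CARD('a) ^ e + 1" and n: "n > 0"
    and h: "[h ^ (CARD('a) ^ e) * h = - 1] (mod nega_modulus n)"
  shows "nega_unitary n (coeff (h mod nega_modulus n))"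
    and "[vec_poly n (coeff (h mod nega_modulus n)) = h] (mod nega_modulus n)"
proof -
  let ?M = "nega_modulus n :: 'a poly" and ?Q = "CARD('a) ^ e"
  let ?v = "coeff (h mod ?M)"
  have "coeff (h mod ?M) i = 0" if "i \<ge> n" for i
    using degree_mod_less'[of ?M h] degree_nega_modulus[OF n, where ?'a = 'a] that
    by (cases "h mod ?M = 0") (auto intro: coeff_eq_0)
  then have v: "vec_poly n ?v = h mod ?M" by (rule vec_poly_coeff)
  then show 1: "[vec_poly n ?v = h] (mod ?M)" by simp
  have "[vec_poly n ?v * vec_poly n (nega_conj n ?v) = h * h ^ ?Q] (mod ?M)"
    by (intro cong_mult 1 cong_trans[OF cong_sym[OF vec_poly_nega_conj_cong[OF dvd]]] cong_pow)
  also have "h * h ^ ?Q = h ^ ?Q * h" by (rule mult.commute)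
  also note h
  finally show "nega_unitary n ?v" unfolding nega_unitary_def .
qed

lemma card_polys_zero_const:
  fixes m :: nat
  defines "C \<equiv> {c::'a::{finite,field} poly. (\<forall>i>m. coeff c i = 0) \<and> coeff c 0 = 0}"
  shows "finite C" "card C = CARD('a) ^ m"
proof -
  have eq: "C = pCons 0 ` {c. \<forall>i\<ge>m. coeff c i = 0}"
  proof (intro equalityI subsetI)
    fix c assume c: "c \<in> C"
    obtain b r where br: "c = pCons b r" by (cases c)
    have "coeff r i = 0" if "i \<ge> m" for i
      using c that unfolding C_def br by (auto dest: spec[of _ "Suc i"])
    then show "c \<in> pCons 0 ` {c. \<forall>i\<ge>m. coeff c i = 0}"
      using c unfolding C_def br by auto
  next
    fix c :: "'a poly" assume "c \<in> pCons 0 ` {c. \<forall>i\<ge>m. coeff c i = 0}"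
    then show "c \<in> C" by (auto simp: C_def coeff_pCons split: nat.split)
  qed
  show "finite C" unfolding eq by (intro finite_imageI card_polys_degree_less)
  show "card C = CARD('a) ^ m"
    unfolding eq by (subst card_image) (auto simp: inj_on_def card_polys_degree_less)
qed

lemma weight_restrict: "weight N (restrict v {..<N}) = weight N v"
  by (rule weight_cong) simp

text \<open>By contradiction, every twist would have a nonzero word of weight below
  \<open>d\<close>. These words are pairwise distinct, so the ball would contain at least q^m of
  them.\<close>

lemma exists_good_unitary:
  fixes p d :: nat
  assumes p: "p \<in> good_primes CARD('a::{finite,field})" and q: "CARD('a) mod 4 = 3"
    and d: "d \<le> p"
    and ball: "card {v \<in> {..<4 * p} \<rightarrow>\<^sub>E (UNIV :: 'a set). weight (4 * p) v < d} < CARD('a) ^ ((p - 3) div 2)"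
  shows "\<exists>h :: nat \<Rightarrow> 'a. nega_unitary (2 * p) h \<and>
    (\<forall>u. (\<exists>i<2 * p. u i \<noteq> 0) \<longrightarrow> d \<le> weight (4 * p) (double_word (2 * p) h u))"
proof (rule ccontr)
  assume neg: "\<not> ?thesis"
  let ?M = "nega_modulus (2 * p) :: 'a poly"
  have pp: "prime p" "p mod 4 = 3" "coprime p CARD('a)" "ord (4 * p) CARD('a) = p - 1"
    using p by (auto simp: good_primes_def)
  have p3: "p \<ge> 3" and oddp: "odd p" using pp(2) by presburger+
  have oddq: "odd CARD('a)" using q by presburger
  have n: "2 * p > 0" using p3 by simp
  define e where "e = (p - 1) div 2"
  define Q where "Q = CARD('a) ^ e"
  define m where "m = (p - 3) div 2"
  have dvd: "2 * (2 * p) dvd CARD('a) ^ e + 1"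
    using good_primes_dvd[OF p q] unfolding e_def by (simp only: mult.assoc[symmetric]) simp
  have two: "(2 :: 'a) \<noteq> 0"
  proof
    assume "(2 :: 'a) = 0"
    then have "of_nat 2 = (0 :: 'a)" by simp
    then have "CHAR('a) dvd 2" by (simp only: of_nat_eq_0_iff_char_dvd)
    moreover have "CHAR('a) \<noteq> 1" by simp
    ultimately have "CHAR('a) = 2" using two_is_prime_nat by (metis prime_nat_iff)
    then show False using CHAR_dvd_CARD[where ?'a = 'a] oddq by simp
  qed
  obtain h0 :: "'a poly" where h0: "[h0 ^ (CARD('a) ^ e) * h0 = - 1] (mod ?M)"
    by (rule base_unitary_poly[OF oddq dvd])
  define H where "H c = cayley_poly (2 * p) (CARD('a) ^ e) h0 c" for c
  define h where "h c = coeff (H c mod ?M)" for c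
  have H: "[H c ^ (CARD('a) ^ e) * H c = - 1] (mod ?M)" for c
    unfolding H_def by (rule cayley_poly_unitary[OF dvd two h0])
  have unitary: "nega_unitary (2 * p) (h c)" and h_cong: "[vec_poly (2 * p) (h c) = H c] (mod ?M)" for c
    unfolding h_def by (rule nega_unitary_coeff_mod[OF dvd n H])+
  have "\<exists>u. (\<exists>i<2 * p. u i \<noteq> 0) \<and> weight (4 * p) (double_word (2 * p) (h c) u) < d" for c
    using neg unitary[of c] by (meson not_le)
  then obtain u where u: "\<And>c. \<exists>i<2 * p. u c i \<noteq> 0"
    and uw: "\<And>c. weight (4 * p) (double_word (2 * p) (h c) (u c)) < d" by metis
  define C where "C = {c::'a poly. (\<forall>i>m. coeff c i = 0) \<and> coeff c 0 = 0}"
  define word where "word c = restrict (double_word (2 * p) (h c) (u c)) {..<4 * p}" for c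
  have inj: "inj_on word C"
  proof (rule inj_onI)
    fix c c' assume c: "c \<in> C" "c' \<in> C" and eq: "word c = word c'"
    have eqj: "double_word (2 * p) (h c) (u c) j = double_word (2 * p) (h c') (u c') j" if "j < 4 * p" for j
      using fun_cong[OF eq, of j] that by (simp add: word_def)
    have ueq: "u c i = u c' i" if "i < 2 * p" for i
      using eqj[of i] that by (simp add: double_word_def)
    have veq: "vec_negacirc (2 * p) (u c) (h c) i = vec_negacirc (2 * p) (u c') (h c') i" if "i < 2 * p" for i
      using eqj[of "2 * p + i"] that by (simp add: double_word_def)
    let ?U = "vec_poly (2 * p) (u c)"
    have U: "vec_poly (2 * p) (u c') = ?U" by (rule vec_poly_cong) (simp add: ueq)
    have prod: "[vec_poly (2 * p) (vec_negacirc (2 * p) (u b) (h b)) = vec_poly (2 * p) (u b) * H b] (mod ?M)" for b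
      using cong_trans[OF vec_poly_vec_negacirc cong_scalar_left[OF h_cong]] .
    have "vec_poly (2 * p) (vec_negacirc (2 * p) (u c) (h c)) =
        vec_poly (2 * p) (vec_negacirc (2 * p) (u c') (h c'))"
      by (rule vec_poly_cong) (rule veq)
    then have "[?U * H c = ?U * H c'] (mod ?M)"
      using cong_trans[OF cong_sym[OF prod[of c]]] prod[of c'] unfolding U by metis
    then have skew: "[?U * ((c - c') - (c - c') ^ (CARD('a) ^ e)) = 0] (mod ?M)"
      unfolding H_def by (rule cayley_poly_inj[OF dvd two h0])
    define f where "f = c - c'"
    have f: "\<And>i. i > m \<Longrightarrow> coeff f i = 0" "coeff f 0 = 0"
      using c by (auto simp: f_def C_def)
    define g where "g = X ^ m * f - (\<Sum>i\<le>m. monom (coeff f i) (m - i))"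
    \<comment> \<open>The choice of \<open>m\<close> makes \<open>2 * m = p - 3\<close>, so
      \<open>degree g\<close> stays below \<open>p - 1\<close>, the least possible degree of an
      irreducible factor.\<close>
    have m: "m \<le> 2 * p" "2 * m < p - 1" using p3 unfolding m_def by linarith+
    have Ug: "[?U * g = 0] (mod ?M)"
      unfolding g_def by (rule skew_cong_low_degree[OF dvd m(1) f(1) skew[folded f_def]])
    have g: "degree g \<le> 2 * m" "g = 0 \<Longrightarrow> f = 0"
      unfolding g_def using skew_low_degree[OF f] by blast+
    have M: "?M = (X ^ 2 + 1) * alt_sum_poly p"
      using oddp unfolding alt_sum_poly_mult by (simp add: nega_modulus_def monom_power add.commute)
    have alt0: "alt_sum_poly p \<noteq> (0 :: 'a poly)"
      using M degree_nega_modulus(2)[OF n, where ?'a = 'a] by auto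
    have "g = 0"
    proof (rule ccontr)
      assume g0: "g \<noteq> 0"
      have "alt_sum_poly p dvd ?U"
      proof (rule dvd_of_dvd_mult_small_degree[OF _ alt0 g0])
        have "alt_sum_poly p dvd ?M" unfolding M by simp
        then show "alt_sum_poly p dvd ?U * g" using Ug unfolding cong_0_iff by (rule dvd_trans)
        fix \<phi> :: "'a poly" assume "irreducible \<phi>" "\<phi> dvd alt_sum_poly p"
        then have "p - 1 \<le> degree \<phi>"
          using irreducible_factor_degree[OF pp(1) oddp pp(3) oddq] pp(4) by simp
        then show "degree g < degree \<phi>" using g(1) m(2) by linarith
      qed
      then have "?M dvd ?U * (X ^ 2 + 1)" unfolding M by (subst mult.commute[of ?U]) (rule mult_dvd_mono, simp_all)
      then have zero: "[?U * (X ^ 2 + 1) = 0] (mod ?M)" by (simp only: cong_0_iff)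
      obtain j where "j < 2 * p" "u c j \<noteq> 0" using u by blast
      \<comment> \<open>The left half alone already has weight at least \<open>p\<close>,
        contradicting weight below \<open>d \<le> p\<close>.\<close>
      then have "p \<le> weight (2 * p) (u c)"
        unfolding weight_def by (rule weight_of_alt_sum_multiple[OF oddp zero])
      also have "\<dots> \<le> weight (2 * (2 * p)) (double_word (2 * p) (h c) (u c))"
        unfolding weight_double_word by simp
      finally show False using uw[of c] d by simp
    qed
    then show "c = c'" using g(2) by (simp add: f_def)
  qed
  have "word ` C \<subseteq> {v \<in> {..<4 * p} \<rightarrow>\<^sub>E (UNIV :: 'a set). weight (4 * p) v < d}"
    using uw by (auto simp: word_def weight_restrict split: if_splits)
  moreover have "finite {v \<in> {..<4 * p} \<rightarrow>\<^sub>E (UNIV :: 'a set). weight (4 * p) v < d}"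
    by (rule finite_subset[of _ "{..<4 * p} \<rightarrow>\<^sub>E (UNIV :: 'a set)"]) (auto intro: finite_PiE)
  ultimately have "card (word ` C) \<le> card {v \<in> {..<4 * p} \<rightarrow>\<^sub>E (UNIV :: 'a set). weight (4 * p) v < d}"
    by (intro card_mono)
  moreover have "card (word ` C) = CARD('a) ^ m"
    using card_image[OF inj] card_polys_zero_const(2)[of m, where ?'a = 'a] by (simp add: C_def)
  ultimately show False using ball by (simp add: m_def)
qed

text \<open>The hypothesis \<open>large\<close> compares exponents of q: at most 4p H(t) for the
  ball against m = (p - 3)/2 for the family.\<close>

lemma exists_unitary_min_dist:
  fixes p :: nat and t :: real
  assumes p: "p \<in> good_primes CARD('a::{finite,field})" and q: "CARD('a) mod 4 = 3"
    and t: "0 < t" "t \<le> 1 / 4"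
    and large: "4 * real p * entropy CARD('a) t < (real p - 3) / 2"
  shows "\<exists>h :: nat \<Rightarrow> 'a. nega_unitary (2 * p) h \<and>
    t * real (4 * p) \<le> real (min_dist (4 * p) (double_negacirc_code (2 * p) h))"
proof -
  have pp: "p mod 4 = 3" using p by (simp add: good_primes_def)
  then have p3: "p \<ge> 3" and "even (p - 3)" by presburger+
  have q3: "CARD('a) \<ge> 3" using q by presburger
  \<comment> \<open>Rounding up serves both ends: distance \<open>d\<close> implies distance
    \<open>t * 4 * p\<close>, and weights below \<open>d\<close> stay inside the ball of that
    radius.\<close>
  define d where "d = nat \<lceil>t * real (4 * p)\<rceil>"
  have d_ge: "t * real (4 * p) \<le> real d" unfolding d_def by linarith
  have "t * real (4 * p) \<le> 1 / 4 * real (4 * p)" using t(2) by (rule mult_right_mono) simp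
  then have "t * real (4 * p) \<le> real p" by simp
  then have d_le: "d \<le> p" unfolding d_def by (simp add: ceiling_le_iff)
  let ?B = "{v \<in> {..<4 * p} \<rightarrow>\<^sub>E (UNIV :: 'a set). weight (4 * p) v < d}"
  let ?B' = "{v \<in> {..<4 * p} \<rightarrow>\<^sub>E (UNIV :: 'a set). real (card {j. j < 4 * p \<and> v j \<noteq> 0}) \<le> t * real (4 * p)}"
  have "real w \<le> t * real (4 * p)" if "w < d" for w
    using that unfolding d_def by linarith
  then have "?B \<subseteq> ?B'" by (auto simp: weight_def)
  moreover have "finite ?B'"
    by (rule finite_subset[of _ "{..<4 * p} \<rightarrow>\<^sub>E (UNIV :: 'a set)"]) (auto intro: finite_PiE)
  ultimately have "real (card ?B) \<le> real (card ?B')" by (simp add: card_mono)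
  also have "\<dots> \<le> real CARD('a) powr (real (4 * p) * entropy CARD('a) t)"
  proof (rule card_ball_le[OF t(1)])
    have "1 / 4 \<le> (real CARD('a) - 1) / real CARD('a)" using q3 by (simp add: field_simps)
    then show "t \<le> (real CARD('a) - 1) / real CARD('a)" using t(2) by linarith
  qed
  also have "\<dots> < real CARD('a) powr ((real p - 3) / 2)"
    using large q3 by (intro powr_less_mono) simp_all
  also have "(real p - 3) / 2 = real ((p - 3) div 2)"
    using p3 \<open>even (p - 3)\<close> by (simp add: real_of_nat_div of_nat_diff)
  also have "real CARD('a) powr real ((p - 3) div 2) = real (CARD('a) ^ ((p - 3) div 2))"
    using q3 by (simp add: powr_realpow)
  finally have "card ?B < CARD('a) ^ ((p - 3) div 2)" by (simp only: of_nat_less_iff)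
  from exists_good_unitary[OF p q d_le this] obtain h :: "nat \<Rightarrow> 'a" where h: "nega_unitary (2 * p) h"
    and w: "\<And>u. \<exists>i<2 * p. u i \<noteq> 0 \<Longrightarrow> d \<le> weight (4 * p) (double_word (2 * p) h u)" by blast
  have "d \<le> min_dist (2 * (2 * p)) (double_negacirc_code (2 * p) h)"
    using w p3 by (intro min_dist_double_ge) simp_all
  then show ?thesis using h d_ge by (intro exI[of _ h]) simp
qed

text \<open>Supplies a self-dual code also for those primes that are too small for the counting
  argument.\<close>

lemma exists_unitary:
  assumes p: "p \<in> good_primes CARD('a::{finite,field})" and q: "CARD('a) mod 4 = 3"
  shows "\<exists>h :: nat \<Rightarrow> 'a. nega_unitary (2 * p) h"
proof -
  have p0: "2 * p > 0" using p by (auto simp: good_primes_def)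
  have dvd: "2 * (2 * p) dvd CARD('a) ^ ((p - 1) div 2) + 1"
    using good_primes_dvd[OF p q] by (simp only: mult.assoc[symmetric]) simp
  have "odd CARD('a)" using q by presburger
  from base_unitary_poly[OF this dvd] nega_unitary_coeff_mod(1)[OF dvd p0] show ?thesis by metis
qed

section \<open>Passage to the limit\<close>

lemma Hq_ge:
  assumes q: "q \<ge> 3" and s: "0 < s" "s < (real q - 1) / real q" "s \<le> x"
    and c: "c \<le> entropy q s" "c \<le> 1"
  shows "c \<le> Hq q x"
proof (cases "x < (real q - 1) / real q")
  case True
  have "entropy q s \<le> entropy q x"
    using entropy_strict_mono[of q s x] q s True by (cases "s = x") auto
  then show ?thesis using True s c by (simp add: Hq_def entropy_def)
next
  case False
  then show ?thesis using s c by (simp add: Hq_def)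
qed

text \<open>The upper bound 1 keeps the limit inferior finite, since \<open>real_of_ereal\<close>
  would send infinity to 0.\<close>

lemma le_real_of_liminf:
  fixes f :: "nat \<Rightarrow> real"
  assumes s: "0 < s" and ev: "\<And>t. 0 < t \<Longrightarrow> t < s \<Longrightarrow> \<forall>\<^sub>F k in sequentially. t \<le> f k"
    and le: "\<And>k. f k \<le> 1"
  shows "s \<le> real_of_ereal (liminf (\<lambda>k. ereal (f k)))"
proof -
  let ?L = "liminf (\<lambda>k. ereal (f k))"
  have "ereal s \<le> ?L"
    unfolding le_Liminf_iff
  proof (intro allI impI)
    fix y assume "y < ereal s"
    then have "max y 0 < ereal s" using s by simp
    then obtain t where t: "max y 0 < ereal t" "ereal t < ereal s" using ereal_dense2 by blast
    then have t0: "0 < t" "t < s" "y < ereal t" by auto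
    from ev[OF t0(1,2)] show "\<forall>\<^sub>F k in sequentially. y < ereal (f k)"
      by eventually_elim (use t0(3) in \<open>auto intro: less_le_trans\<close>)
  qed
  moreover have "?L \<le> liminf (\<lambda>k. ereal 1)"
    by (intro Liminf_mono always_eventually) (simp add: le)
  then have "?L \<le> ereal 1" by (simp add: Liminf_const)
  ultimately show ?thesis by (cases ?L) auto
qed

theorem theorem5p2:
  fixes q :: nat
  assumes field_size: "CARD('a::{finite,field}) = q"
    and q_mod: "q mod 4 = 3"
    and inf_primes: "infinite (good_primes q)"
  shows "(\<exists>P h. P \<subseteq> good_primes q \<and> infinite P \<and>
            (\<forall>p\<in>P. self_dual (2 * (2 * p)) (double_negacirc_code (2 * p) (h p :: nat \<Rightarrow> 'a))) \<and>
            Hq q (real_of_ereal (rel_dist P (\<lambda>p. 2 * (2 * p))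
                   (\<lambda>p. double_negacirc_code (2 * p) (h p)))) \<ge> 1 / 8)
       \<and> (\<exists>P a b. P \<subseteq> good_primes q \<and> infinite P \<and>
            (\<forall>p\<in>P. self_dual (4 * (2 * p)) (four_negacirc_code (2 * p) (a p :: nat \<Rightarrow> 'a) (b p))) \<and>
            Hq q (real_of_ereal (rel_dist P (\<lambda>p. 4 * (2 * p))
                   (\<lambda>p. four_negacirc_code (2 * p) (a p) (b p)))) \<ge> 1 / 16)"
proof -
  define P where "P = good_primes q"
  have q3: "q \<ge> 3" using q_mod by presburger
  have infP: "infinite P" using inf_primes by (simp add: P_def)
  have p_pos: "p > 0" if "p \<in> P" for p
    using that by (auto simp: P_def good_primes_def)
  define D where "D p h = min_dist (2 * (2 * p)) (double_negacirc_code (2 * p) h)" for p and h :: "nat \<Rightarrow> 'a"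
  have D_le: "D p h \<le> 2 * (2 * p)" if "p \<in> P" for p h
    unfolding D_def using p_pos[OF that] by (intro min_dist_le_length[OF double_code_nontrivial]) simp_all
  \<comment> \<open>The code chosen for each prime maximises the minimum distance. One family,
    independent of \<open>t\<close>, then eventually beats every \<open>t\<close> below
    \<open>s\<close>.\<close>
  have "\<exists>h. nega_unitary (2 * p) h \<and> (\<forall>h'. nega_unitary (2 * p) h' \<longrightarrow> D p h' \<le> D p h)" if p: "p \<in> P" for p
  proof -
    obtain h0 :: "nat \<Rightarrow> 'a" where "nega_unitary (2 * p) h0"
      using exists_unitary[where ?'a = 'a, unfolded field_size, OF _ q_mod] p unfolding P_def by blast
    moreover have "\<forall>h'. nega_unitary (2 * p) h' \<longrightarrow> D p h' < Suc (2 * (2 * p))"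
      using D_le[OF p] by (simp add: less_Suc_eq_le)
    ultimately show ?thesis by (rule Lattices_Big.ex_has_greatest_nat)
  qed
  then obtain h where unitary: "\<And>p. p \<in> P \<Longrightarrow> nega_unitary (2 * p) (h p)"
    and best: "\<And>p h'. p \<in> P \<Longrightarrow> nega_unitary (2 * p) h' \<Longrightarrow> D p h' \<le> D p (h p)" by metis
  obtain s where s: "0 < s" "s \<le> 1 / 4" "entropy q s = 1 / 8" using entropy_eighth[OF q3] .
  have quarter: "1 / 4 < (real q - 1) / real q" using q3 by (simp add: field_simps)
  then have s_less: "s < (real q - 1) / real q" "s / 2 < (real q - 1) / real q" using s by linarith+
  have en: "enumerate P k \<in> P" "k \<le> enumerate P k" for k
    using infP by (simp_all add: enumerate_in_set le_enumerate)
  have ev: "\<forall>\<^sub>F k in sequentially. t * real (2 * (2 * enumerate P k)) \<le> real (D (enumerate P k) (h (enumerate P k)))"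
    if t: "0 < t" "t < s" for t
  proof -
    have H: "entropy q t < 1 / 8"
      using entropy_strict_mono[of q t s] t s q3 quarter by simp
    \<comment> \<open>The inequality 4p H(t) < (p - 3)/2 rearranges to p(1 - 8 H(t)) > 3, and the
      \<open>k\<close>-th prime of the enumeration is at least \<open>k\<close>.\<close>
    obtain k0 :: nat where k0: "3 / (1 - 8 * entropy q t) < real k0" using reals_Archimedean2 by blast
    show ?thesis
    proof (rule eventually_sequentiallyI[of k0])
      fix k assume k: "k0 \<le> k"
      let ?p = "enumerate P k"
      have "3 / (1 - 8 * entropy q t) < real ?p" using k0 k en(2)[of k] by linarith
      then have "3 < real ?p * (1 - 8 * entropy q t)" using H by (simp add: pos_divide_less_eq)
      then have "4 * real ?p * entropy q t < (real ?p - 3) / 2" by (simp add: algebra_simps)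
      then obtain h' :: "nat \<Rightarrow> 'a" where h': "nega_unitary (2 * ?p) h'"
        and "t * real (4 * ?p) \<le> real (min_dist (4 * ?p) (double_negacirc_code (2 * ?p) h'))"
        using exists_unitary_min_dist[where ?'a = 'a, unfolded field_size, OF _ q_mod t(1), of ?p]
          en(1)[of k] t(2) s(2) unfolding P_def by fastforce
      then have "t * real (2 * (2 * ?p)) \<le> real (D ?p h')" by (simp add: D_def)
      also have "\<dots> \<le> real (D ?p (h ?p))" using best[OF en(1) h'] by simp
      finally show "t * real (2 * (2 * ?p)) \<le> real (D ?p (h ?p))" .
    qed
  qed
  have "1 / 8 \<le> Hq q (real_of_ereal (rel_dist P (\<lambda>p. 2 * (2 * p)) (\<lambda>p. double_negacirc_code (2 * p) (h p))))"
  proof (rule Hq_ge[OF q3 s(1)])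
    show "s \<le> real_of_ereal (rel_dist P (\<lambda>p. 2 * (2 * p)) (\<lambda>p. double_negacirc_code (2 * p) (h p)))"
      unfolding rel_dist_def
    proof (rule le_real_of_liminf[OF s(1)])
      fix t assume "0 < t" "t < s"
      from ev[OF this] show "\<forall>\<^sub>F k in sequentially. t \<le> real (min_dist (2 * (2 * enumerate P k))
          (double_negacirc_code (2 * enumerate P k) (h (enumerate P k)))) / real (2 * (2 * enumerate P k))"
        by eventually_elim (use p_pos[OF en(1)] in \<open>simp add: D_def pos_le_divide_eq\<close>)
    next
      fix k
      show "real (min_dist (2 * (2 * enumerate P k)) (double_negacirc_code (2 * enumerate P k)
          (h (enumerate P k)))) / real (2 * (2 * enumerate P k)) \<le> 1"
        using D_le[OF en(1), of k "h (enumerate P k)"] p_pos[OF en(1), of k]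
        by (simp add: D_def divide_le_eq_1)
    qed
  qed (use s s_less in simp_all)
  moreover have "self_dual (2 * (2 * p)) (double_negacirc_code (2 * p) (h p))" if "p \<in> P" for p
    by (intro self_dual_double unitary that)
  moreover have "1 / 16 \<le> Hq q (real_of_ereal (rel_dist P (\<lambda>p. 4 * (2 * p))
      (\<lambda>p. four_negacirc_code (2 * p) (h p) (\<lambda>_. 0))))"
  proof (rule Hq_ge[OF q3])
    show "s / 2 \<le> real_of_ereal (rel_dist P (\<lambda>p. 4 * (2 * p)) (\<lambda>p. four_negacirc_code (2 * p) (h p) (\<lambda>_. 0)))"
      unfolding rel_dist_def
    proof (rule le_real_of_liminf)
      fix t assume "0 < t" "t < s / 2"
      \<comment> \<open>The length doubles while the minimum distance does not drop, so the bound is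
        applied to \<open>2 * t\<close>.\<close>
      then have "0 < 2 * t" "2 * t < s" by auto
      from ev[OF this] show "\<forall>\<^sub>F k in sequentially. t \<le> real (min_dist (4 * (2 * enumerate P k))
          (four_negacirc_code (2 * enumerate P k) (h (enumerate P k)) (\<lambda>_. 0))) / real (4 * (2 * enumerate P k))"
      proof eventually_elim
        fix k assume *: "2 * t * real (2 * (2 * enumerate P k)) \<le> real (D (enumerate P k) (h (enumerate P k)))"
        have "D (enumerate P k) (h (enumerate P k)) \<le> min_dist (4 * (2 * enumerate P k))
            (four_negacirc_code (2 * enumerate P k) (h (enumerate P k)) (\<lambda>_. 0))"
          unfolding D_def using p_pos[OF en(1), of k] by (intro min_dist_four_ge unitary en(1)) simp
        then show "t \<le> real (min_dist (4 * (2 * enumerate P k))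
            (four_negacirc_code (2 * enumerate P k) (h (enumerate P k)) (\<lambda>_. 0))) / real (4 * (2 * enumerate P k))"
          using * p_pos[OF en(1), of k] by (simp add: pos_le_divide_eq)
      qed
    next
      fix k
      have "2 * enumerate P k > 0" using p_pos[OF en(1), of k] by simp
      then obtain x y where "x \<in> four_negacirc_code (2 * enumerate P k) (h (enumerate P k)) (\<lambda>_. 0)"
        "y \<in> four_negacirc_code (2 * enumerate P k) (h (enumerate P k)) (\<lambda>_. 0)" "x \<noteq> y"
        by (rule four_code_nontrivial)
      then have "min_dist (4 * (2 * enumerate P k))
          (four_negacirc_code (2 * enumerate P k) (h (enumerate P k)) (\<lambda>_. 0)) \<le> 4 * (2 * enumerate P k)"
        by (rule min_dist_le_length)
      then show "real (min_dist (4 * (2 * enumerate P k)) (four_negacirc_code (2 * enumerate P k)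
          (h (enumerate P k)) (\<lambda>_. 0))) / real (4 * (2 * enumerate P k)) \<le> 1"
        using p_pos[OF en(1), of k] by (simp add: divide_le_eq_1)
    qed (use s in simp)
    show "1 / 16 \<le> entropy q (s / 2)" using entropy_half_ge[of q s] s q3 by simp
  qed (use s s_less in simp_all)
  moreover have "self_dual (4 * (2 * p)) (four_negacirc_code (2 * p) (h p) (\<lambda>_. 0))" if "p \<in> P" for p
    by (intro self_dual_four unitary that)
  moreover have "P \<subseteq> good_primes q" by (simp add: P_def)
  ultimately show ?thesis
    using infP by (intro conjI exI[of _ P] exI[of _ h] exI[of _ "\<lambda>_ _. 0"] ballI) assumption+
qed

end
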